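(* Let $A, B \in \mathbb{P}$ with $A \# B \leq I$. Then $$A^{p+1} \# (A \#_{\frac{p}{2}} B) \leq A$$ for any $p > 0$. In particular, $A^{3} \# B \leq A$ (the case $p = 2$).
   Context: $\mathcal{H}$ is a Hilbert space, $B(\mathcal{H})$ is the space of bounded linear operators on $\mathcal{H}$, $I$ is the identity operator, and $\mathbb{P} \subset B(\mathcal{H})$ is the open convex cone of positive definite (that is, self-adjoint, positive and invertible) operators. For self-adjoint $X, Y$, $X \leq Y$ means that $Y - X$ is positive semi-definite (Loewner order). For $A, B \in \mathbb{P}$ and any real $s$, $A \#_{s} B := A^{1/2} (A^{-1/2} B A^{-1/2})^{s} A^{1/2}$, and $A \# B := A \#_{1/2} B$. Real powers of positive definite operators are taken by functional calculus. *)

theory Defs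
  imports "HOL-Analysis.Analysis" "HOL-Computational_Algebra.Polynomial"
begin

text \<open>
  Complex Hilbert spaces. The real structure inherited from \<^class>\<open>banach\<close> is the restriction of
  the complex one; completeness is part of \<^class>\<open>banach\<close>, and positive definiteness of the inner
  product follows from \<open>cinner_self\<close>. The inner product is linear in its second argument.
\<close>

class complex_hilbert = banach +
  fixes scaleC :: "complex \<Rightarrow> 'a \<Rightarrow> 'a"  (infixr \<open>*\<^sub>C\<close> 75)
    and cinner :: "'a \<Rightarrow> 'a \<Rightarrow> complex"
  assumes scaleC_of_real: "complex_of_real r *\<^sub>C x = r *\<^sub>R x"
    and scaleC_add_right: "c *\<^sub>C (x + y) = c *\<^sub>C x + c *\<^sub>C y"
    and scaleC_add_left: "(c + d) *\<^sub>C x = c *\<^sub>C x + d *\<^sub>C x"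
    and scaleC_scaleC: "c *\<^sub>C d *\<^sub>C x = (c * d) *\<^sub>C x"
    and cinner_commute: "cinner x y = cnj (cinner y x)"
    and cinner_add_right: "cinner x (y + z) = cinner x y + cinner x z"
    and cinner_scaleC_right: "cinner x (c *\<^sub>C y) = c * cinner x y"
    and cinner_self: "cinner x x = complex_of_real ((norm x)\<^sup>2)"

instantiation complex :: complex_hilbert
begin

definition scaleC_complex :: "complex \<Rightarrow> complex \<Rightarrow> complex"
  where "scaleC_complex c x = c * x"

definition cinner_complex :: "complex \<Rightarrow> complex \<Rightarrow> complex"
  where "cinner_complex x y = cnj x * y"

instance
proof
  fix x :: complex
  show "cinner x x = complex_of_real ((norm x)\<^sup>2)"
    unfolding cinner_complex_def by (metis complex_norm_square mult.commute)
qed (simp_all add: scaleC_complex_def cinner_complex_def scaleR_conv_of_real algebra_simps)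

end

lemma norm_scaleC: "norm (c *\<^sub>C (x::'a::complex_hilbert)) = cmod c * norm x"
proof -
  have "cinner (c *\<^sub>C x) (c *\<^sub>C x) = c * cnj (cinner x (c *\<^sub>C x))"
    by (metis cinner_commute cinner_scaleC_right)
  also have "\<dots> = (c * cnj c) * cnj (cinner x x)"
    by (simp add: cinner_scaleC_right)
  also have "\<dots> = complex_of_real ((cmod c * norm x)\<^sup>2)"
    by (simp add: cinner_self complex_norm_square[symmetric] power_mult_distrib)
  finally have "(norm (c *\<^sub>C x))\<^sup>2 = (cmod c * norm x)\<^sup>2"
    unfolding cinner_self by (simp only: of_real_eq_iff)
  then show ?thesis
    by (simp add: power2_eq_iff_nonneg)
qed

lemma bounded_linear_scaleC: "bounded_linear (\<lambda>x::'a::complex_hilbert. c *\<^sub>C x)"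
proof (rule bounded_linear_intro[where K = "cmod c"])
  fix r :: real and x :: 'a
  show "c *\<^sub>C r *\<^sub>R x = r *\<^sub>R c *\<^sub>C x"
    by (simp add: scaleC_of_real[symmetric] scaleC_scaleC mult.commute)
qed (simp_all add: scaleC_add_right norm_scaleC mult.commute)

text \<open>
  \<open>B(H)\<close>: the library type \<open>'a \<Rightarrow>\<^sub>L 'a\<close> consists of the bounded \<^emph>\<open>real\<close>-linear maps, so complex
  homogeneity is required in addition. The operator norm is the same for both scalar fields.
\<close>

definition bounded_ops :: "('a::complex_hilbert \<Rightarrow>\<^sub>L 'a) set"
  where "bounded_ops = {A. \<forall>c x. blinfun_apply A (c *\<^sub>C x) = c *\<^sub>C blinfun_apply A x}"

definition scalar_op :: "complex \<Rightarrow> 'a::complex_hilbert \<Rightarrow>\<^sub>L 'a"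
  where "scalar_op c = Blinfun (\<lambda>x. c *\<^sub>C x)"

lemma scalar_op_apply [simp]: "blinfun_apply (scalar_op c) x = c *\<^sub>C x"
  by (simp add: scalar_op_def bounded_linear_Blinfun_apply bounded_linear_scaleC)

definition invertible_op :: "('a::complex_hilbert \<Rightarrow>\<^sub>L 'a) \<Rightarrow> bool"
  where "invertible_op A \<longleftrightarrow>
    (\<exists>T\<in>bounded_ops. A o\<^sub>L T = id_blinfun \<and> T o\<^sub>L A = id_blinfun)"

definition self_adjoint :: "('a::complex_hilbert \<Rightarrow>\<^sub>L 'a) \<Rightarrow> bool"
  where "self_adjoint A \<longleftrightarrow> A \<in> bounded_ops \<and>
    (\<forall>x y. cinner (blinfun_apply A x) y = cinner x (blinfun_apply A y))"

definition pos_semidef :: "('a::complex_hilbert \<Rightarrow>\<^sub>L 'a) \<Rightarrow> bool"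
  where "pos_semidef A \<longleftrightarrow> self_adjoint A \<and> (\<forall>x. cinner x (blinfun_apply A x) \<in> \<real>\<^sub>\<ge>\<^sub>0)"

definition pos_def :: "('a::complex_hilbert \<Rightarrow>\<^sub>L 'a) set"
  where "pos_def = {A. pos_semidef A \<and> invertible_op A}"

definition loewner_le :: "('a::complex_hilbert \<Rightarrow>\<^sub>L 'a) \<Rightarrow> ('a \<Rightarrow>\<^sub>L 'a) \<Rightarrow> bool"
    (infix \<open>\<le>\<^sub>L\<close> 50)
  where "X \<le>\<^sub>L Y \<longleftrightarrow> pos_semidef (Y - X)"

definition op_spectrum :: "('a::complex_hilbert \<Rightarrow>\<^sub>L 'a) \<Rightarrow> complex set"
  where "op_spectrum A = {z. \<not> invertible_op (A - scalar_op z)}"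

definition poly_op :: "real poly \<Rightarrow> ('a::complex_hilbert \<Rightarrow>\<^sub>L 'a) \<Rightarrow> 'a \<Rightarrow>\<^sub>L 'a"
  where "poly_op p A = (\<Sum>i\<le>degree p. coeff p i *\<^sub>R (((o\<^sub>L) A ^^ i) id_blinfun))"

text \<open>
  Continuous functional calculus for a self-adjoint operator \<open>A\<close> and a real function \<open>f\<close> continuous
  on the spectrum (a compact set of real numbers): \<open>f(A)\<close> is the common limit, in operator norm, of
  \<open>p\<^sub>n(A)\<close> for all sequences of real polynomials \<open>p\<^sub>n\<close> converging to \<open>f\<close> uniformly on the spectrum.
  The value is unspecified for other \<open>A\<close> and \<open>f\<close>.
\<close>

definition fun_calc :: "(real \<Rightarrow> real) \<Rightarrow> ('a::complex_hilbert \<Rightarrow>\<^sub>L 'a) \<Rightarrow> 'a \<Rightarrow>\<^sub>L 'a"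
  where "fun_calc f A = (THE T. \<forall>p.
    uniform_limit {t. complex_of_real t \<in> op_spectrum A} (\<lambda>n. poly (p n)) f sequentially
      \<longrightarrow> (\<lambda>n. poly_op (p n) A) \<longlonglongrightarrow> T)"

definition op_powr :: "('a::complex_hilbert \<Rightarrow>\<^sub>L 'a) \<Rightarrow> real \<Rightarrow> 'a \<Rightarrow>\<^sub>L 'a"
  where "op_powr A s = fun_calc (\<lambda>t. t powr s) A"

definition wgeo_mean ::
    "('a::complex_hilbert \<Rightarrow>\<^sub>L 'a) \<Rightarrow> real \<Rightarrow> ('a \<Rightarrow>\<^sub>L 'a) \<Rightarrow> 'a \<Rightarrow>\<^sub>L 'a"
  where "wgeo_mean A s B =
    op_powr A (1/2) o\<^sub>L op_powr (op_powr A (-1/2) o\<^sub>L B o\<^sub>L op_powr A (-1/2)) s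
      o\<^sub>L op_powr A (1/2)"

definition geo_mean :: "('a::complex_hilbert \<Rightarrow>\<^sub>L 'a) \<Rightarrow> ('a \<Rightarrow>\<^sub>L 'a) \<Rightarrow> 'a \<Rightarrow>\<^sub>L 'a"
    (infixl \<open>#\<^sub>m\<close> 70)
  where "A #\<^sub>m B = wgeo_mean A (1/2) B"

end

theory Submission
  imports Defs "HOL-Computational_Algebra.Fundamental_Theorem_Algebra"
begin

text \<open>
  Put \<open>C = A\<^sup>-\<^sup>1\<^sup>/\<^sup>2 B A\<^sup>-\<^sup>1\<^sup>/\<^sup>2\<close> and \<open>D = C\<^sup>1\<^sup>/\<^sup>2\<close>. Congruence by \<open>A\<^sup>1\<^sup>/\<^sup>2\<close> turns the hypothesis into
  \<open>D \<le> A\<inverse>\<close> and the claim into \<open>A\<^sup>p # D\<^sup>p \<le> I\<close>. For \<open>p \<le> 1\<close> the Loewner--Heinz inequality gives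
  \<open>D\<^sup>p \<le> A\<^sup>-\<^sup>p\<close>, hence \<open>A\<^sup>p # D\<^sup>p \<le> A\<^sup>p # A\<^sup>-\<^sup>p = I\<close>; larger exponents follow by repeated doubling, since
  \<open>X # Y \<le> I\<close> implies \<open>X\<^sup>2 # Y\<^sup>2 \<le> I\<close>. All facts about \<open>X # Y\<close> come from its characterization as the
  positive definite solution \<open>G\<close> of the Riccati equation \<open>G X\<inverse> G = Y\<close>.
\<close>

section \<open>Self-adjoint operators and the real inner product\<close>

text \<open>Above exponent 1 the Loewner-Heinz inequality fails in general, so
  \<open>D \<le> A^-1\<close> need not give \<open>D^p \<le> A^-p\<close>; what survives doubling of
  the exponent is the bound on the mean by the identity. The other obstacle is that powers exist
  only as limits of polynomials in the operator. They become usable once the norm of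
  \<open>p(A)\<close> is bounded by the supremum of \<open>|p|\<close> on the spectrum. That bound
  comes from the zeros of \<open>N^2 - p^2\<close>, which may be non-real, so polynomials with
  complex coefficients appear beside the real ones. That \<open>G^2 \<le> H^2\<close> implies
  \<open>G \<le> H\<close> is proved from quadratic forms alone, without square roots. It yields
  both the uniqueness in the Riccati equation and the monotonicity of the mean. Monotonicity in turn
  gives Loewner-Heinz: the mean of two powers of one operator is the power at the midpoint of the
  exponents, so an inequality at exponents 0 and 1 spreads to all dyadic exponents between
  them.\<close>

definition rinner :: "'a::complex_hilbert \<Rightarrow> 'a \<Rightarrow> real"
  where "rinner x y = Re (cinner x y)"

lemma rinner_commute: "rinner x y = rinner y x"
  unfolding rinner_def by (subst cinner_commute) simp

lemma rinner_add_right: "rinner x (y + z) = rinner x y + rinner x z"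
  by (simp add: rinner_def cinner_add_right)

lemma rinner_scaleR_right: "rinner x (r *\<^sub>R y) = r * rinner x y"
  by (simp add: rinner_def scaleC_of_real[symmetric] cinner_scaleC_right)

lemma rinner_add_left: "rinner (x + y) z = rinner x z + rinner y z"
  by (metis rinner_add_right rinner_commute)

lemma rinner_scaleR_left: "rinner (r *\<^sub>R x) y = r * rinner x y"
  by (metis rinner_scaleR_right rinner_commute)

lemma rinner_self: "rinner x x = (norm x)\<^sup>2"
  by (simp add: rinner_def cinner_self)

lemma quadratic_nonneg_imp_discriminant:
  fixes a b c :: real
  assumes "\<And>t. 0 \<le> a + 2 * t * b + t\<^sup>2 * c" and "0 \<le> c"
  shows "b\<^sup>2 \<le> a * c"
proof (cases "c = 0")
  case True
  have "b = 0"
  proof (rule ccontr)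
    assume "b \<noteq> 0"
    \<comment> \<open>At this \<open>t\<close> the affine function \<open>a + 2 * t * b\<close>
      takes the value -1.\<close>
    then show False
      using assms(1)[of "- (a + 1) / (2 * b)"] True by (simp add: field_simps)
  qed
  then show ?thesis using True by simp
next
  case False
  then have "c > 0" using assms(2) by simp
  then show ?thesis
    using assms(1)[of "- b / c"] by (simp add: field_simps power2_eq_square)
qed

lemma norm_add_square: "(norm (x + y))\<^sup>2 = (norm x)\<^sup>2 + 2 * rinner x y + (norm y)\<^sup>2"
  using rinner_commute[of y x]
  by (simp add: rinner_self[symmetric] rinner_add_left rinner_add_right)

lemma rinner_square_le: "(rinner x y)\<^sup>2 \<le> (norm x)\<^sup>2 * (norm y)\<^sup>2"
proof (rule quadratic_nonneg_imp_discriminant)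
  fix t
  have "0 \<le> (norm (x + t *\<^sub>R y))\<^sup>2"
    by simp
  also have "\<dots> = (norm x)\<^sup>2 + 2 * t * rinner x y + t\<^sup>2 * (norm y)\<^sup>2"
    by (simp add: norm_add_square rinner_scaleR_right power_mult_distrib)
  finally show "0 \<le> (norm x)\<^sup>2 + 2 * t * rinner x y + t\<^sup>2 * (norm y)\<^sup>2" .
qed simp

lemma abs_rinner_le: "\<bar>rinner x y\<bar> \<le> norm x * norm y"
  using rinner_square_le[of x y] abs_le_square_iff[of "rinner x y" "norm x * norm y"]
  by (simp add: power_mult_distrib)

lemma bounded_bilinear_rinner: "bounded_bilinear rinner"
proof (rule bounded_bilinear.intro)
  show "\<exists>K. \<forall>a b. norm (rinner a b) \<le> norm a * norm b * K"
    by (rule exI[of _ 1]) (simp add: abs_rinner_le)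
qed (simp_all add: rinner_add_left rinner_add_right rinner_scaleR_left rinner_scaleR_right)

interpretation rinner: bounded_bilinear rinner
  by (rule bounded_bilinear_rinner)

lemmas rinner_simps = rinner.add_left rinner.add_right rinner.diff_left rinner.diff_right
  rinner.minus_left rinner.minus_right rinner.scaleR_left rinner.scaleR_right
  rinner.zero_left rinner.zero_right rinner_self

lemma scaleC_zero_right [simp]: "c *\<^sub>C (0::'a::complex_hilbert) = 0"
  using scaleC_add_right[of c 0 "0::'a"] by simp

lemma scaleC_minus_right: "c *\<^sub>C (- x::'a::complex_hilbert) = - (c *\<^sub>C x)"
  using minus_unique[of "c *\<^sub>C x" "c *\<^sub>C (- x)"] scaleC_add_right[of c x "- x"] by simp

lemma scaleC_diff_right: "c *\<^sub>C (x - y::'a::complex_hilbert) = c *\<^sub>C x - c *\<^sub>C y"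
  using scaleC_add_right[of c x "- y"] by (simp add: scaleC_minus_right)

lemma scaleC_scaleR: "c *\<^sub>C (r *\<^sub>R x::'a::complex_hilbert) = r *\<^sub>R c *\<^sub>C x"
  by (simp add: scaleC_of_real[symmetric] scaleC_scaleC mult.commute)

lemma scaleC_one [simp]: "1 *\<^sub>C (x::'a::complex_hilbert) = x"
  using scaleC_of_real[of 1 x] by simp

lemma scaleC_zero_left [simp]: "0 *\<^sub>C (x::'a::complex_hilbert) = 0"
  using scaleC_of_real[of 0 x] by simp

lemma rinner_scaleC_ii: "rinner x (\<i> *\<^sub>C y) = - Im (cinner x y)"
  by (simp add: rinner_def cinner_scaleC_right)

text \<open>\<open>op_closed\<close> collects closure of the operator classes under operations;
  \<open>op_upcast\<close> collects the inclusions from \<open>pos_def\<close> through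
  \<open>pos_semidef\<close> and \<open>self_adjoint\<close> to \<open>bounded_ops\<close>.\<close>

named_theorems op_closed
named_theorems op_upcast

lemma bounded_ops_apply: "A \<in> bounded_ops \<Longrightarrow> blinfun_apply A (c *\<^sub>C x) = c *\<^sub>C blinfun_apply A x"
  by (simp add: bounded_ops_def)

lemma bounded_ops_id [op_closed]: "id_blinfun \<in> bounded_ops"
  by (simp add: bounded_ops_def)

lemma bounded_ops_zero [op_closed]: "0 \<in> bounded_ops"
  by (simp add: bounded_ops_def)

lemma bounded_ops_scalar [op_closed]: "scalar_op c \<in> bounded_ops"
  by (simp add: bounded_ops_def scaleC_scaleC mult.commute)

lemma bounded_ops_compose [op_closed]:
  "A \<in> bounded_ops \<Longrightarrow> B \<in> bounded_ops \<Longrightarrow> A o\<^sub>L B \<in> bounded_ops"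
  by (simp add: bounded_ops_def)

lemma bounded_ops_add [op_closed]:
  "A \<in> bounded_ops \<Longrightarrow> B \<in> bounded_ops \<Longrightarrow> A + B \<in> bounded_ops"
  by (simp add: bounded_ops_def blinfun.add_left scaleC_add_right)

lemma bounded_ops_diff [op_closed]:
  "A \<in> bounded_ops \<Longrightarrow> B \<in> bounded_ops \<Longrightarrow> A - B \<in> bounded_ops"
  by (simp add: bounded_ops_def blinfun.diff_left scaleC_diff_right)

lemma bounded_ops_scaleR [op_closed]: "A \<in> bounded_ops \<Longrightarrow> r *\<^sub>R A \<in> bounded_ops"
  by (simp add: bounded_ops_def blinfun.scaleR_left scaleC_scaleR)

text \<open>The imaginary part of the complex identity is, up to sign, the real identity at
  \<open>\<i> *\<^sub>C y\<close>, because \<open>A\<close> commutes with \<i>. Estimates can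
  therefore be made with real numbers throughout.\<close>

lemma self_adjoint_iff:
  "self_adjoint A \<longleftrightarrow> A \<in> bounded_ops \<and> (\<forall>x y. rinner (A x) y = rinner x (A y))"
proof (intro iffI conjI allI)
  assume *: "A \<in> bounded_ops \<and> (\<forall>x y. rinner (A x) y = rinner x (A y))"
  show "self_adjoint A"
    unfolding self_adjoint_def
  proof (intro conjI allI)
    fix x y
    have "rinner (A x) (\<i> *\<^sub>C y) = rinner x (\<i> *\<^sub>C A y)"
      using * bounded_ops_apply by metis
    then have "Im (cinner (A x) y) = Im (cinner x (A y))"
      by (simp add: rinner_scaleC_ii)
    moreover have "Re (cinner (A x) y) = Re (cinner x (A y))"
      using * by (simp add: rinner_def)
    ultimately show "cinner (A x) y = cinner x (A y)"
      by (simp add: complex_eq_iff)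
  qed (use * in blast)
qed (auto simp: self_adjoint_def rinner_def)

lemma self_adjoint_bounded_ops [op_upcast]: "self_adjoint A \<Longrightarrow> A \<in> bounded_ops"
  by (simp add: self_adjoint_def)

lemma self_adjoint_apply: "self_adjoint A \<Longrightarrow> rinner (A x) y = rinner x (A y)"
  by (simp add: self_adjoint_iff)

lemma pos_semidef_iff: "pos_semidef A \<longleftrightarrow> self_adjoint A \<and> (\<forall>x. 0 \<le> rinner x (A x))"
proof -
  have "Im (cinner x (A x)) = 0" if "self_adjoint A" for x
  proof -
    have "cinner x (A x) = cnj (cinner x (A x))"
      using that by (metis cinner_commute self_adjoint_def)
    then show ?thesis by (metis Reals_cnj_iff complex_is_Real_iff)
  qed
  then show ?thesis
    by (auto simp: pos_semidef_def rinner_def complex_nonneg_Reals_iff)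
qed

lemma self_adjoint_id [op_closed]: "self_adjoint id_blinfun"
  by (simp add: self_adjoint_iff op_closed)

lemma self_adjoint_zero [op_closed]: "self_adjoint 0"
  by (simp add: self_adjoint_iff op_closed rinner_simps)

lemma self_adjoint_add [op_closed]: "self_adjoint A \<Longrightarrow> self_adjoint B \<Longrightarrow> self_adjoint (A + B)"
  by (simp add: self_adjoint_iff op_closed blinfun.add_left rinner_simps)

lemma self_adjoint_diff [op_closed]: "self_adjoint A \<Longrightarrow> self_adjoint B \<Longrightarrow> self_adjoint (A - B)"
  by (simp add: self_adjoint_iff op_closed blinfun.diff_left rinner_simps)

lemma self_adjoint_scaleR [op_closed]: "self_adjoint A \<Longrightarrow> self_adjoint (r *\<^sub>R A)"
  by (simp add: self_adjoint_iff op_closed blinfun.scaleR_left rinner_simps)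

lemma self_adjoint_commuting:
  assumes "self_adjoint A" "self_adjoint B" "A o\<^sub>L B = B o\<^sub>L A"
  shows "self_adjoint (A o\<^sub>L B)"
proof -
  have "A (B x) = B (A x)" for x
    using assms(3) by (metis blinfun_apply_blinfun_compose)
  then show ?thesis
    using assms(1,2) by (simp add: self_adjoint_iff op_closed)
qed

lemma self_adjoint_congruence [op_closed]:
  "self_adjoint A \<Longrightarrow> self_adjoint T \<Longrightarrow> self_adjoint (T o\<^sub>L A o\<^sub>L T)"
  by (simp add: self_adjoint_iff op_closed)

lemma pos_semidef_self_adjoint [op_upcast]: "pos_semidef A \<Longrightarrow> self_adjoint A"
  by (simp add: pos_semidef_iff)

lemma pos_semidef_apply: "pos_semidef A \<Longrightarrow> 0 \<le> rinner x (A x)"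
  by (simp add: pos_semidef_iff)

lemma pos_semidef_add [op_closed]: "pos_semidef A \<Longrightarrow> pos_semidef B \<Longrightarrow> pos_semidef (A + B)"
  by (simp add: pos_semidef_iff op_closed blinfun.add_left rinner_simps)

lemma pos_semidef_congruence [op_closed]:
  assumes "pos_semidef A" "self_adjoint T"
  shows "pos_semidef (T o\<^sub>L A o\<^sub>L T)"
  unfolding pos_semidef_iff
proof (intro conjI allI)
  show "self_adjoint (T o\<^sub>L A o\<^sub>L T)"
    using assms by (simp add: self_adjoint_congruence pos_semidef_self_adjoint)
  show "0 \<le> rinner x ((T o\<^sub>L A o\<^sub>L T) x)" for x
    using pos_semidef_apply[OF assms(1), of "T x"] self_adjoint_apply[OF assms(2), of x "A (T x)"]
    by simp
qed

lemma pos_semidef_square: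
  assumes "self_adjoint T"
  shows "pos_semidef (T o\<^sub>L T)"
  unfolding pos_semidef_iff
proof (intro conjI allI)
  show "self_adjoint (T o\<^sub>L T)"
    using assms by (simp add: self_adjoint_commuting)
  show "0 \<le> rinner x ((T o\<^sub>L T) x)" for x
    using self_adjoint_apply[OF assms, of x "T x"] by (simp add: rinner_self[symmetric])
      (metis rinner_self zero_le_power2)
qed

lemma pos_def_pos_semidef [op_upcast]: "A \<in> pos_def \<Longrightarrow> pos_semidef A"
  by (simp add: pos_def_def)

lemma pos_def_self_adjoint [op_upcast]: "A \<in> pos_def \<Longrightarrow> self_adjoint A"
  by (simp add: op_upcast)

section \<open>Lower bounds of quadratic forms and invertibility\<close>

lemma pos_semidef_cauchy_schwarz:
  assumes "pos_semidef A"
  shows "(rinner x (A y))\<^sup>2 \<le> rinner x (A x) * rinner y (A y)"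
proof (rule quadratic_nonneg_imp_discriminant)
  fix t
  have "0 \<le> rinner (x + t *\<^sub>R y) (A (x + t *\<^sub>R y))"
    using assms by (rule pos_semidef_apply)
  also have "\<dots> = rinner x (A x) + 2 * t * rinner x (A y) + t\<^sup>2 * rinner y (A y)"
    using rinner_commute[of "A x" y] self_adjoint_apply[of A x y] assms
    by (simp add: rinner_simps blinfun.add_right blinfun.scaleR_right op_upcast
        power2_eq_square algebra_simps)
  finally show "0 \<le> rinner x (A x) + 2 * t * rinner x (A y) + t\<^sup>2 * rinner y (A y)" .
qed (use assms pos_semidef_apply in blast)

text \<open>Cauchy-Schwarz for the form of \<open>A\<close>, applied to \<open>x\<close> and
  \<open>A x\<close>, gives this after cancelling one factor \<open>|A x|^2\<close>. It lets the
  form control \<open>A x\<close> itself at a stage where no square root of \<open>A\<close> is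
  available.\<close>

lemma pos_semidef_norm_apply_le:
  assumes "pos_semidef A"
  shows "(norm (A x))\<^sup>2 \<le> norm A * rinner x (A x)"
proof (cases "A x = 0")
  case True
  then show ?thesis by (simp add: rinner_simps)
next
  case False
  have "((norm (A x))\<^sup>2)\<^sup>2 = (rinner x (A (A x)))\<^sup>2"
    using assms by (metis pos_semidef_self_adjoint rinner_self self_adjoint_apply)
  also have "\<dots> \<le> rinner x (A x) * rinner (A x) (A (A x))"
    by (rule pos_semidef_cauchy_schwarz[OF assms])
  also have "\<dots> \<le> rinner x (A x) * (norm A * (norm (A x))\<^sup>2)"
  proof (rule mult_left_mono)
    have "rinner (A x) (A (A x)) \<le> norm (A x) * norm (A (A x))"
      using abs_rinner_le[of "A x" "A (A x)"] by simp
    also have "\<dots> \<le> norm (A x) * (norm A * norm (A x))"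
      by (intro mult_left_mono norm_blinfun) simp
    finally show "rinner (A x) (A (A x)) \<le> norm A * (norm (A x))\<^sup>2"
      by (simp add: power2_eq_square algebra_simps)
  qed (rule pos_semidef_apply[OF assms])
  finally have "(norm (A x))\<^sup>2 * (norm (A x))\<^sup>2 \<le> (norm A * rinner x (A x)) * (norm (A x))\<^sup>2"
    by (simp only: power2_eq_square ac_simps)
  then show ?thesis by (rule mult_right_le_imp_le) (use False in simp)
qed

lemma pos_def_bounded_below:
  assumes "A \<in> pos_def"
  obtains c where "c > 0" "\<And>x. c * (norm x)\<^sup>2 \<le> rinner x (A x)"
proof -
  have psd: "pos_semidef A" using assms by (rule pos_def_pos_semidef)
  obtain T where T: "T o\<^sub>L A = id_blinfun"
    using assms by (auto simp: pos_def_def invertible_op_def)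
  \<comment> \<open>The summand 1 keeps \<open>K\<close> positive on the zero space, where both
    norms vanish.\<close>
  define K where "K = (norm T)\<^sup>2 * norm A + 1"
  have K: "K > 0" by (simp add: K_def add_nonneg_pos)
  have "(norm x)\<^sup>2 \<le> K * rinner x (A x)" for x
  proof -
    have "norm x = norm (T (A x))"
      using T by (metis blinfun_apply_blinfun_compose blinfun_apply_id_blinfun id_apply)
    then have "norm x \<le> norm T * norm (A x)"
      using norm_blinfun by metis
    then have "(norm x)\<^sup>2 \<le> (norm T)\<^sup>2 * (norm (A x))\<^sup>2"
      by (metis norm_ge_zero power_mono power_mult_distrib)
    also have "\<dots> \<le> (norm T)\<^sup>2 * (norm A * rinner x (A x))"
      by (intro mult_left_mono pos_semidef_norm_apply_le psd) simp
    also have "\<dots> \<le> K * rinner x (A x)"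
      using pos_semidef_apply[OF psd, of x] by (simp add: K_def algebra_simps)
    finally show ?thesis .
  qed
  then show thesis
    using K by (intro that[of "1 / K"]) (auto simp: field_simps)
qed

text \<open>Solving \<open>A x = y\<close> is a fixed point problem: with
  \<open>K = norm A + c\<close> the map sending \<open>x\<close> to \<open>x - (A x - y) / K\<close>
  contracts distances by \<open>sqrt (1 - c / K)\<close>, so Banach's theorem applies. The lower
  bound also gives injectivity and the bound \<open>1 / c\<close> for the inverse.\<close>

lemma bounded_below_invertible:
  assumes A: "self_adjoint A" and c: "c > 0" and bd: "\<And>x. c * (norm x)\<^sup>2 \<le> rinner x (A x)"
  shows "invertible_op A"
proof -
  have "0 \<le> rinner x (A x)" for x
    using order_trans[of 0 "c * (norm x)\<^sup>2" "rinner x (A x)"] bd c by simp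
  then have psd: "pos_semidef A"
    using A by (simp add: pos_semidef_iff)
  have lower: "c * norm x \<le> norm (A x)" for x
  proof (cases "x = 0")
    case False
    have "c * (norm x)\<^sup>2 \<le> norm x * norm (A x)"
      using bd[of x] abs_rinner_le[of x "A x"] by linarith
    then show ?thesis using False by (simp add: power2_eq_square)
  qed simp
  define K where "K = norm A + c"
  have K: "K > 0" "norm A \<le> K" "c \<le> K" using c by (auto simp: K_def add_nonneg_pos)
  have contr: "norm (x - (1 / K) *\<^sub>R A x) \<le> sqrt (1 - c / K) * norm x" for x
  proof (rule power2_le_imp_le)
    have "(norm (x - (1 / K) *\<^sub>R A x))\<^sup>2
        = (norm x)\<^sup>2 - 2 / K * rinner x (A x) + (norm (A x))\<^sup>2 / K\<^sup>2"
      using norm_add_square[of x "- (1 / K) *\<^sub>R A x"]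
      by (simp add: rinner.scaleR_right rinner.minus_right power_mult_distrib power_divide)
    also have "(norm (A x))\<^sup>2 / K\<^sup>2 \<le> rinner x (A x) / K"
    proof -
      have "(norm (A x))\<^sup>2 \<le> K * rinner x (A x)"
        using pos_semidef_norm_apply_le[OF psd, of x]
          mult_right_mono[OF K(2) pos_semidef_apply[OF psd, of x]] by linarith
      then show ?thesis
        using K by (simp add: power2_eq_square field_simps)
    qed
    also have "(norm x)\<^sup>2 - 2 / K * rinner x (A x) + rinner x (A x) / K
        = (norm x)\<^sup>2 - rinner x (A x) / K"
      by (simp add: field_simps)
    also have "\<dots> \<le> (norm x)\<^sup>2 - c * (norm x)\<^sup>2 / K"
      using bd[of x] K by (simp add: divide_right_mono)
    also have "\<dots> = (sqrt (1 - c / K) * norm x)\<^sup>2"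
      using K by (simp add: power_mult_distrib algebra_simps)
    finally show "(norm (x - (1 / K) *\<^sub>R A x))\<^sup>2 \<le> (sqrt (1 - c / K) * norm x)\<^sup>2"
      by simp
  qed (use K in simp)
  have surj: "\<exists>x. A x = y" for y
  proof -
    define f where "f x = x - (1 / K) *\<^sub>R (A x - y)" for x
    have "\<exists>!x. f x = x"
    proof (rule banach_fix_type)
      show "0 \<le> sqrt (1 - c / K)" "sqrt (1 - c / K) < 1" using K c by auto
      show "\<forall>x z. dist (f x) (f z) \<le> sqrt (1 - c / K) * dist x z"
      proof (intro allI)
        fix x z
        have "f x - f z = (x - z) - (1 / K) *\<^sub>R A (x - z)"
          by (simp add: f_def blinfun.diff_right scaleR_diff_right)
        then show "dist (f x) (f z) \<le> sqrt (1 - c / K) * dist x z"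
          using contr[of "x - z"] by (simp add: dist_norm)
      qed
    qed
    then show ?thesis using K by (auto simp: f_def)
  qed
  define g where "g y = (SOME x. A x = y)" for y
  have Ag: "A (g y) = y" for y
    unfolding g_def using surj by (rule someI_ex)
  have inj: "x = z" if "A x = A z" for x z
    using lower[of "x - z"] that c by (simp add: blinfun.diff_right mult_le_0_iff)
  have "bounded_linear g"
  proof (rule bounded_linear_intro[where K = "1 / c"])
    show "norm (g y) \<le> norm y * (1 / c)" for y
      using lower[of "g y"] c by (simp add: Ag field_simps)
  \<comment> \<open>Linearity of \<open>g\<close> follows from injectivity: after applying
    \<open>A\<close>, both sides of each equation agree by \<open>Ag\<close>. Complex homogeneity is
    obtained below in the same way.\<close>
  qed (rule inj, simp add: Ag blinfun.add_right blinfun.scaleR_right)+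
  then have T: "blinfun_apply (Blinfun g) = g"
    by (rule bounded_linear_Blinfun_apply)
  have "Blinfun g \<in> bounded_ops"
    unfolding bounded_ops_def T mem_Collect_eq
    by (intro allI, rule inj) (simp add: Ag bounded_ops_apply[OF self_adjoint_bounded_ops[OF A]])
  then show ?thesis
    unfolding invertible_op_def
    by (intro bexI[of _ "Blinfun g"] conjI blinfun_eqI)
      (use inj Ag in \<open>simp_all add: T\<close>)
qed

lemma pos_def_iff_bounded_below:
  "A \<in> pos_def \<longleftrightarrow> self_adjoint A \<and> (\<exists>c>0. \<forall>x. c * (norm x)\<^sup>2 \<le> rinner x (A x))"
proof safe
  fix c :: real assume *: "self_adjoint A" "c > 0" "\<forall>x. c * (norm x)\<^sup>2 \<le> rinner x (A x)"
  then have "0 \<le> rinner x (A x)" for x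
    using order_trans[of 0 "c * (norm x)\<^sup>2" "rinner x (A x)"] by simp
  then show "A \<in> pos_def"
    using * bounded_below_invertible[of A c] by (simp add: pos_def_def pos_semidef_iff)
next
  assume A: "A \<in> pos_def"
  then show "self_adjoint A" by (rule pos_def_self_adjoint)
  show "\<exists>c>0. \<forall>x. c * (norm x)\<^sup>2 \<le> rinner x (A x)"
    using pos_def_bounded_below[OF A] by metis
qed

section \<open>Norm limits and the order of squares\<close>

lemma self_adjoint_limit:
  assumes "\<And>n. self_adjoint (X n)" "X \<longlonglongrightarrow> T"
  shows "self_adjoint T"
proof -
  have lim: "(\<lambda>n. X n x) \<longlonglongrightarrow> T x" for x
    by (intro blinfun.tendsto assms tendsto_const)
  have "T \<in> bounded_ops"
    unfolding bounded_ops_def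
  proof safe
    fix c x
    have "(\<lambda>n. c *\<^sub>C X n x) \<longlonglongrightarrow> c *\<^sub>C T x"
      using bounded_linear.tendsto[OF bounded_linear_scaleC lim] .
    moreover have "c *\<^sub>C X n x = X n (c *\<^sub>C x)" for n
      using assms(1)[of n] by (simp add: bounded_ops_apply op_upcast)
    ultimately show "T (c *\<^sub>C x) = c *\<^sub>C T x"
      using LIMSEQ_unique[OF lim[of "c *\<^sub>C x"]] by simp
  qed
  moreover have "rinner (T x) y = rinner x (T y)" for x y
  proof -
    have "(\<lambda>n. rinner (X n x) y) \<longlonglongrightarrow> rinner (T x) y" "(\<lambda>n. rinner x (X n y)) \<longlonglongrightarrow> rinner x (T y)"
      by (intro rinner.tendsto lim tendsto_const)+
    moreover have "rinner (X n x) y = rinner x (X n y)" for n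
      by (rule self_adjoint_apply[OF assms(1)])
    ultimately show ?thesis using LIMSEQ_unique by auto
  qed
  ultimately show ?thesis by (simp add: self_adjoint_iff)
qed

lemma pos_semidef_limit:
  assumes "\<And>n. pos_semidef (X n)" "X \<longlonglongrightarrow> T"
  shows "pos_semidef T"
  unfolding pos_semidef_iff
proof (intro conjI allI)
  show "self_adjoint T"
    by (rule self_adjoint_limit[OF pos_semidef_self_adjoint assms(2)]) (rule assms(1))
  fix x
  have "(\<lambda>n. rinner x (X n x)) \<longlonglongrightarrow> rinner x (T x)"
    by (intro rinner.tendsto blinfun.tendsto assms tendsto_const)
  then show "0 \<le> rinner x (T x)"
    using assms(1) by (intro LIMSEQ_le_const) (auto simp: pos_semidef_apply)
qed

text \<open>Let \<open>m\<close> be the greatest lower bound of the form of \<open>Z = H - G\<close>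
  on unit vectors, and suppose it is negative. Then \<open>R = Z - m\<close> is positive, and the
  comparison of squares forces it to be bounded below by some \<open>e > 0\<close>, so that
  \<open>m + e\<close> is still a lower bound for \<open>Z\<close>. This contradicts the choice of
  \<open>m\<close>.\<close>

lemma square_le_imp_le:
  assumes G: "pos_semidef G" and H: "H \<in> pos_def" and le: "pos_semidef ((H o\<^sub>L H) - (G o\<^sub>L G))"
  shows "pos_semidef (H - G)"
proof (rule ccontr)
  assume not: "\<not> pos_semidef (H - G)"
  define Z where "Z = H - G"
  define W where "W = H + G"
  have sa: "self_adjoint Z" "self_adjoint W" "self_adjoint G" "self_adjoint H"
    using G H by (auto simp: Z_def W_def op_closed op_upcast)
  define S where "S = {t. \<forall>x. t * (norm x)\<^sup>2 \<le> rinner x (Z x)}"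
  obtain x0 where x0: "rinner x0 (Z x0) < 0"
    using not sa by (auto simp: pos_semidef_iff Z_def not_le)
  then have x0n: "norm x0 > 0" by (auto simp: rinner_simps)
  have bdd: "bdd_above S"
    using x0n by (intro bdd_aboveI[of _ "rinner x0 (Z x0) / (norm x0)\<^sup>2"]) (auto simp: S_def field_simps)
  have ne: "- norm Z \<in> S"
    unfolding S_def
  proof safe
    fix x
    have "\<bar>rinner x (Z x)\<bar> \<le> norm x * (norm Z * norm x)"
      by (rule order_trans[OF abs_rinner_le mult_left_mono[OF norm_blinfun]]) simp
    then show "- norm Z * (norm x)\<^sup>2 \<le> rinner x (Z x)"
      by (simp add: power2_eq_square algebra_simps abs_le_iff)
  qed
  define m where "m = Sup S"
  have mS: "m * (norm x)\<^sup>2 \<le> rinner x (Z x)" for x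
  proof (cases "x = 0")
    case False
    have "m \<le> rinner x (Z x) / (norm x)\<^sup>2"
      unfolding m_def
    proof (rule cSup_least)
      show "S \<noteq> {}" using ne by blast
      show "t \<le> rinner x (Z x) / (norm x)\<^sup>2" if "t \<in> S" for t
        using that False by (simp add: S_def pos_le_divide_eq)
    qed
    then show ?thesis using False by (simp add: field_simps)
  qed (simp add: rinner_simps)
  have m: "m < 0"
  proof (rule ccontr)
    assume "\<not> m < 0"
    then have "0 \<le> m * (norm x0)\<^sup>2" by simp
    with mS[of x0] x0 show False by simp
  qed
  define R where "R = Z - m *\<^sub>R id_blinfun"
  have R: "pos_semidef R"
    using sa mS by (simp add: pos_semidef_iff R_def op_closed blinfun.diff_left blinfun.scaleR_left rinner_simps)
  obtain c where c: "c > 0" "\<And>x. c * (norm x)\<^sup>2 \<le> rinner x (H x)"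
    using pos_def_bounded_below[OF H] by blast
  have W: "c * (norm x)\<^sup>2 \<le> rinner x (W x)" for x
    using c(2)[of x] pos_semidef_apply[OF G, of x] by (simp add: W_def blinfun.add_left rinner_simps)
  \<comment> \<open>\<open>ZW + WZ = 2 (H\<^sup>2 - G\<^sup>2)\<close>, so the form below is nonnegative, although at an approximate
    eigenvector of \<open>Z\<close> for \<open>m\<close> it is about \<open>m \<langle>x, Wx\<rangle> \<le> m c\<close>.\<close>
  have ZW: "0 \<le> rinner (Z x) (W x)" for x
  proof -
    have "rinner (Z x) (W x) = rinner (H x) (H x) - rinner (G x) (G x)"
      by (simp add: Z_def W_def blinfun.add_left blinfun.diff_left rinner.add_right
          rinner.diff_left rinner_commute[of "G x" "H x"])
    also have "\<dots> = rinner x (((H o\<^sub>L H) - (G o\<^sub>L G)) x)"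
      using sa by (simp add: blinfun.diff_left rinner.diff_right self_adjoint_apply)
    finally show ?thesis using pos_semidef_apply[OF le] by simp
  qed
  define L where "L = norm R * (norm W)\<^sup>2 + 1"
  have L: "L > 0" by (simp add: L_def add_nonneg_pos)
  \<comment> \<open>The lower bound for \<open>R\<close> arises from
    \<open>- (m * c) * |x| \<le> |R x| * |W|\<close>, whose left side is nonnegative, by squaring
    and inserting \<open>|R x|^2 \<le> |R| * rinner x (R x)\<close>; \<open>L\<close> absorbs the
    two norms and stays positive.\<close>
  define e where "e = (m * c)\<^sup>2 / (2 * L)"
  have e: "e > 0" using m c L by (simp add: e_def)
  have lower: "e * (norm x)\<^sup>2 \<le> rinner x (R x)" for x
  proof (cases "x = 0")
    case False
    have "- (m * c) * (norm x)\<^sup>2 \<le> rinner (R x) (W x)"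
    proof -
      have "0 \<le> rinner (R x) (W x) + m * rinner x (W x)"
        using ZW[of x] by (simp add: R_def blinfun.diff_left blinfun.scaleR_left rinner_simps)
      moreover have "m * rinner x (W x) \<le> m * (c * (norm x)\<^sup>2)"
        using W[of x] m by (simp add: mult_left_mono_neg)
      ultimately show ?thesis by simp
    qed
    also have "\<dots> \<le> norm (R x) * norm (W x)"
      using abs_rinner_le[of "R x" "W x"] by simp
    also have "\<dots> \<le> norm (R x) * (norm W * norm x)"
      by (intro mult_left_mono norm_blinfun) simp
    finally have "- (m * c) * norm x * norm x \<le> norm (R x) * norm W * norm x"
      by (simp add: power2_eq_square algebra_simps)
    then have "- (m * c) * norm x \<le> norm (R x) * norm W"
      by (rule mult_right_le_imp_le) (use False in simp)
    then have "(- (m * c) * norm x)\<^sup>2 \<le> (norm (R x) * norm W)\<^sup>2"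
      using m c by (intro power_mono) (auto simp: mult_nonpos_nonneg intro: less_imp_le)
    then have "(m * c)\<^sup>2 * (norm x)\<^sup>2 \<le> (norm (R x))\<^sup>2 * (norm W)\<^sup>2"
      by (simp add: power_mult_distrib)
    also have "\<dots> \<le> (norm R * rinner x (R x)) * (norm W)\<^sup>2"
      by (intro mult_right_mono pos_semidef_norm_apply_le R) simp
    also have "\<dots> \<le> L * rinner x (R x)"
      using pos_semidef_apply[OF R, of x] by (simp add: L_def algebra_simps)
    also have "\<dots> \<le> (2 * L) * rinner x (R x)"
      using pos_semidef_apply[OF R, of x] L by simp
    finally show ?thesis
      using L by (simp add: e_def field_simps)
  qed (simp add: rinner_simps)
  have "m + e \<in> S"
    using lower by (simp add: S_def R_def blinfun.diff_left blinfun.scaleR_left rinner_simps algebra_simps)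
  then have "m + e \<le> m"
    unfolding m_def using bdd by (rule cSup_upper)
  with e show False by simp
qed

lemma pos_semidef_antisym:
  assumes "pos_semidef A" "pos_semidef (- A)"
  shows "A = 0"
proof (rule blinfun_eqI)
  fix x
  have "rinner x (A x) = 0"
    using pos_semidef_apply[OF assms(1), of x] pos_semidef_apply[OF assms(2), of x]
    by (simp add: blinfun.minus_left rinner_simps)
  then show "A x = blinfun_apply 0 x"
    using pos_semidef_norm_apply_le[OF assms(1), of x] by simp
qed

text \<open>Equal squares are comparable in both directions. This identifies
  \<open>op_powr C (1/2)\<close> from its square alone, without returning to approximating
  polynomials.\<close>

lemma pos_def_square_root_unique:
  fixes G H :: "'a::complex_hilbert \<Rightarrow>\<^sub>L 'a"
  assumes "G \<in> pos_def" "H \<in> pos_def" "G o\<^sub>L G = H o\<^sub>L H"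
  shows "G = H"
proof -
  have "pos_semidef (0 :: 'a \<Rightarrow>\<^sub>L 'a)" by (simp add: pos_semidef_iff op_closed rinner_simps)
  have "pos_semidef (H - G)" "pos_semidef (G - H)"
    using assms square_le_imp_le[of G H] square_le_imp_le[of H G] \<open>pos_semidef 0\<close>
    by (simp_all add: op_upcast)
  then show ?thesis using pos_semidef_antisym[of "H - G"] by simp
qed

section \<open>Inverses of products and the spectrum of a self-adjoint operator\<close>

interpretation compose: bounded_bilinear "(o\<^sub>L)"
  by (rule bounded_bilinear_blinfun_compose)

lemma blinfun_compose_assoc: "(A o\<^sub>L B) o\<^sub>L C = A o\<^sub>L (B o\<^sub>L C)"
  by (rule blinfun_eqI) simp

lemma blinfun_compose_id [simp]: "A o\<^sub>L id_blinfun = A" "id_blinfun o\<^sub>L A = A"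
  by (rule blinfun_eqI, simp)+

lemma scalar_op_of_real: "scalar_op (complex_of_real r) = r *\<^sub>R id_blinfun"
  by (rule blinfun_eqI) (simp add: scaleC_of_real blinfun.scaleR_left)

lemma invertible_compose:
  assumes "invertible_op A" "invertible_op B"
  shows "invertible_op (A o\<^sub>L B)"
proof -
  obtain S T where "S \<in> bounded_ops" "A o\<^sub>L S = id_blinfun" "S o\<^sub>L A = id_blinfun"
    "T \<in> bounded_ops" "B o\<^sub>L T = id_blinfun" "T o\<^sub>L B = id_blinfun"
    using assms by (auto simp: invertible_op_def)
  then show ?thesis
    unfolding invertible_op_def
    by (intro bexI[of _ "T o\<^sub>L S"])
      (auto simp: op_closed, metis blinfun_compose_assoc blinfun_compose_id(1),
       metis blinfun_compose_assoc blinfun_compose_id(1))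
qed

lemma invertible_uminus:
  assumes "invertible_op A"
  shows "invertible_op (- A)"
proof -
  obtain S where "S \<in> bounded_ops" "A o\<^sub>L S = id_blinfun" "S o\<^sub>L A = id_blinfun"
    using assms by (auto simp: invertible_op_def)
  then show ?thesis
    unfolding invertible_op_def
    using bounded_ops_scaleR[of S "- 1"]
    by (intro bexI[of _ "- S"]) (auto simp: compose.minus_left compose.minus_right)
qed

text \<open>An inverse \<open>T\<close> of the product supplies the right inverse
  \<open>Y o\<^sub>L T\<close> and, by commutation, the left inverse \<open>T o\<^sub>L Y\<close> of
  \<open>X\<close>; the two must coincide.\<close>

lemma invertible_factor_of_commuting:
  assumes Y: "Y \<in> bounded_ops" and comm: "X o\<^sub>L Y = Y o\<^sub>L X" and inv: "invertible_op (X o\<^sub>L Y)"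
  shows "invertible_op X"
proof -
  obtain T where T: "T \<in> bounded_ops" "X o\<^sub>L Y o\<^sub>L T = id_blinfun" "T o\<^sub>L (X o\<^sub>L Y) = id_blinfun"
    using inv by (auto simp: invertible_op_def)
  have right: "X o\<^sub>L (Y o\<^sub>L T) = id_blinfun"
    using T by (simp add: blinfun_compose_assoc)
  have left: "(T o\<^sub>L Y) o\<^sub>L X = id_blinfun"
    using T comm by (simp add: blinfun_compose_assoc)
  have "T o\<^sub>L Y = (T o\<^sub>L Y) o\<^sub>L (X o\<^sub>L (Y o\<^sub>L T))"
    by (simp add: right)
  also have "\<dots> = Y o\<^sub>L T"
    using left by (simp add: blinfun_compose_assoc[symmetric])
  finally show ?thesis
    using left right Y T(1) unfolding invertible_op_def
    by (intro bexI[of _ "Y o\<^sub>L T"]) (simp_all add: op_closed)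
qed

text \<open>With \<open>D = A - Re z\<close>, the factors for \<open>z\<close> and for its conjugate
  commute and multiply to \<open>D^2 + (Im z)^2\<close>, which is bounded below by
  \<open>(Im z)^2\<close>. Invertibility of the product passes to the factor.\<close>

lemma self_adjoint_spectrum_real:
  assumes A: "self_adjoint A" and z: "Im z \<noteq> 0"
  shows "invertible_op (A - scalar_op z)"
proof -
  have bA: "A \<in> bounded_ops" using A by (rule self_adjoint_bounded_ops)
  note Az = bounded_ops_apply[OF bA]
  define X where "X = A - scalar_op z"
  define Y where "Y = A - scalar_op (cnj z)"
  define D where "D = A - Re z *\<^sub>R id_blinfun"
  have D: "self_adjoint D" unfolding D_def using A by (simp add: op_closed)
  have XD: "X x = D x - (\<i> * complex_of_real (Im z)) *\<^sub>C x" for x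
  proof -
    have "z *\<^sub>C x = complex_of_real (Re z) *\<^sub>C x + (\<i> * complex_of_real (Im z)) *\<^sub>C x"
      by (subst complex_eq[of z]) (simp only: scaleC_add_left)
    then show ?thesis
      by (simp add: X_def D_def blinfun.diff_left blinfun.scaleR_left scaleC_of_real)
  qed
  have YD: "Y x = D x + (\<i> * complex_of_real (Im z)) *\<^sub>C x" for x
  proof -
    have "z *\<^sub>C x = cnj z *\<^sub>C x + (2 * \<i> * complex_of_real (Im z)) *\<^sub>C x"
    proof -
      have "z = cnj z + 2 * \<i> * complex_of_real (Im z)"
        by (simp add: complex_eq_iff)
      then show ?thesis by (metis scaleC_add_left)
    qed
    moreover have "(2 * \<i> * complex_of_real (Im z)) *\<^sub>C x
        = (\<i> * complex_of_real (Im z)) *\<^sub>C x + (\<i> * complex_of_real (Im z)) *\<^sub>C x"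
      by (simp add: scaleC_add_left[symmetric] mult.assoc)
    ultimately show ?thesis
      using XD[of x] by (simp add: X_def Y_def blinfun.diff_left algebra_simps)
  qed
  have bD: "D (c *\<^sub>C x) = c *\<^sub>C D x" for c x
    using D by (intro bounded_ops_apply self_adjoint_bounded_ops)
  have ii: "(\<i> * complex_of_real (Im z)) * (\<i> * complex_of_real (Im z)) = complex_of_real (- (Im z)\<^sup>2)"
    by (simp add: complex_eq_iff power2_eq_square)
  have XY: "X (Y x) = D (D x) + (Im z)\<^sup>2 *\<^sub>R x" and YX: "Y (X x) = D (D x) + (Im z)\<^sup>2 *\<^sub>R x" for x
    unfolding XD YD blinfun.add_right blinfun.diff_right bD scaleC_add_right scaleC_diff_right
      scaleC_scaleC ii scaleC_of_real by (simp_all add: scaleC_of_real)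
  have comm: "X o\<^sub>L Y = Y o\<^sub>L X"
    by (rule blinfun_eqI) (simp add: XY YX)
  have "X o\<^sub>L Y = (D o\<^sub>L D) + (Im z)\<^sup>2 *\<^sub>R id_blinfun"
    by (rule blinfun_eqI) (simp add: XY blinfun.add_left blinfun.scaleR_left)
  then have "self_adjoint (X o\<^sub>L Y)"
    using D by (simp add: op_closed self_adjoint_commuting)
  moreover have "(Im z)\<^sup>2 * (norm x)\<^sup>2 \<le> rinner x ((X o\<^sub>L Y) x)" for x
  proof -
    have "rinner x (D (D x)) = (norm (D x))\<^sup>2"
      using self_adjoint_apply[OF D, of x "D x"] by (simp add: rinner_self)
    then show ?thesis
      by (simp add: XY rinner.add_right rinner.scaleR_right rinner_self)
  qed
  ultimately have "invertible_op (X o\<^sub>L Y)"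
    using z by (intro bounded_below_invertible[of _ "(Im z)\<^sup>2"]) auto
  moreover have "Y \<in> bounded_ops"
    unfolding Y_def using bA by (simp add: op_closed)
  ultimately show ?thesis
    using invertible_factor_of_commuting[of Y X] comm by (simp add: X_def)
qed

section \<open>Polynomials of an operator\<close>

text \<open>Real polynomials need not split into linear factors, so evaluation at an operator is
  also set up for complex coefficients, here as a Horner scheme.\<close>

definition cpoly_op :: "complex poly \<Rightarrow> ('a::complex_hilbert \<Rightarrow>\<^sub>L 'a) \<Rightarrow> 'a \<Rightarrow>\<^sub>L 'a"
  where "cpoly_op q A = fold_coeffs (\<lambda>c T. scalar_op c + (A o\<^sub>L T)) q 0"

lemma scalar_op_0 [simp]: "scalar_op 0 = 0"
  by (rule blinfun_eqI) simp

lemma scalar_op_add: "scalar_op (c + d) = scalar_op c + scalar_op d"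
  by (rule blinfun_eqI) (simp add: blinfun.add_left scaleC_add_left)

lemma cpoly_op_0 [simp]: "cpoly_op 0 A = 0"
  by (simp add: cpoly_op_def)

lemma cpoly_op_pCons: "cpoly_op (pCons a q) A = scalar_op a + (A o\<^sub>L cpoly_op q A)"
  by (cases "a = 0 \<and> q = 0") (auto simp: cpoly_op_def)

lemma cpoly_op_add: "cpoly_op (p + q) A = cpoly_op p A + cpoly_op q A"
  by (induction p q rule: poly_induct2)
    (simp_all add: cpoly_op_pCons scalar_op_add compose.add_right algebra_simps)

lemma cpoly_op_smult:
  "A \<in> bounded_ops \<Longrightarrow> cpoly_op (smult c q) A = scalar_op c o\<^sub>L cpoly_op q A"
proof (induction q)
  case (pCons a q)
  then show ?case
    by (intro blinfun_eqI)
      (simp add: cpoly_op_pCons blinfun.add_left scaleC_add_right scaleC_scaleC bounded_ops_apply)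
qed simp

lemma cpoly_op_linear_factor:
  fixes A :: "'a::complex_hilbert \<Rightarrow>\<^sub>L 'a"
  assumes "A \<in> bounded_ops"
  shows "cpoly_op ([:- z, 1:] * q) A = (A - scalar_op z) o\<^sub>L cpoly_op q A"
proof -
  have "scalar_op (- z) = - (scalar_op z :: 'a \<Rightarrow>\<^sub>L 'a)"
    by (rule blinfun_eqI) (metis add.right_inverse blinfun.add_left scalar_op_0 scalar_op_add
        blinfun.minus_left minus_unique)
  moreover have "[:- z, 1:] * q = smult (- z) q + pCons 0 q"
    by simp
  ultimately show ?thesis
    using assms
    by (simp only: cpoly_op_add cpoly_op_smult cpoly_op_pCons)
      (simp add: compose.diff_left compose.minus_left)
qed

text \<open>One inclusion of the spectral mapping theorem: the fundamental theorem of algebra peels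
  off one linear factor at a time, and each factor is invertible by hypothesis.\<close>

lemma cpoly_op_invertible:
  assumes A: "A \<in> bounded_ops"
  shows "q \<noteq> 0 \<Longrightarrow> (\<And>z. poly q z = 0 \<Longrightarrow> invertible_op (A - scalar_op z)) \<Longrightarrow>
    invertible_op (cpoly_op q A)"
proof (induction "degree q" arbitrary: q)
  case 0
  then obtain c where c: "q = [:c:]" "c \<noteq> 0"
    by (metis degree_eq_zeroE pCons_0_0)
  have "scalar_op c o\<^sub>L scalar_op (1 / c) = (id_blinfun :: 'a \<Rightarrow>\<^sub>L 'a)"
    "scalar_op (1 / c) o\<^sub>L scalar_op c = (id_blinfun :: 'a \<Rightarrow>\<^sub>L 'a)"
    by (rule blinfun_eqI, simp add: scaleC_scaleC c)+
  then show ?case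
    unfolding invertible_op_def
    by (intro bexI[of _ "scalar_op (1 / c)"]) (simp_all add: cpoly_op_pCons c op_closed)
next
  case (Suc n)
  then have "\<not> constant (poly q)"
    by (simp add: constant_degree)
  then obtain z where z: "poly q z = 0"
    using fundamental_theorem_of_algebra by blast
  then obtain r where r: "q = [:- z, 1:] * r"
    by (metis dvdE poly_eq_0_iff_dvd)
  have "r \<noteq> 0" using r Suc.prems by auto
  then have "degree q = Suc (degree r)"
    unfolding r by (subst degree_mult_eq) auto
  then have "invertible_op (cpoly_op r A)"
    using Suc \<open>r \<noteq> 0\<close> by (intro Suc.hyps(1)) (auto simp: r)
  then show ?case
    using Suc.prems(2)[OF z] by (simp only: r cpoly_op_linear_factor[OF A] invertible_compose)
qed

text \<open>Padding by zero coefficients is needed for \<open>pCons\<close>, which raises the degree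
  by at most one and leaves it unchanged over the zero polynomial.\<close>

lemma poly_op_extend:
  assumes "degree p \<le> n"
  shows "poly_op p A = (\<Sum>i\<le>n. coeff p i *\<^sub>R (((o\<^sub>L) A ^^ i) id_blinfun))"
  unfolding poly_op_def using assms
  by (intro sum.mono_neutral_left) (auto simp: coeff_eq_0 not_le)

lemma poly_op_0 [simp]: "poly_op 0 A = 0"
  by (simp add: poly_op_def)

lemma poly_op_pCons: "poly_op (pCons a p) A = a *\<^sub>R id_blinfun + (A o\<^sub>L poly_op p A)"
proof -
  have "poly_op (pCons a p) A
      = (\<Sum>i\<le>Suc (degree p). coeff (pCons a p) i *\<^sub>R (((o\<^sub>L) A ^^ i) id_blinfun))"
    by (rule poly_op_extend) (rule degree_pCons_le)
  then show ?thesis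
    by (simp add: sum.atMost_Suc_shift poly_op_def compose.sum_right compose.scaleR_right del: sum.atMost_Suc)
qed

lemma poly_op_const: "poly_op [:c:] A = c *\<^sub>R id_blinfun"
  by (simp add: poly_op_pCons)

lemma poly_op_X: "poly_op [:0, 1:] A = A"
  by (simp add: poly_op_pCons)

lemma poly_op_add: "poly_op (p + q) A = poly_op p A + poly_op q A"
  by (induction p q rule: poly_induct2)
    (simp_all add: poly_op_pCons compose.add_right algebra_simps)

lemma poly_op_smult: "poly_op (smult c q) A = c *\<^sub>R poly_op q A"
  by (induction q) (simp_all add: poly_op_pCons compose.scaleR_right scaleR_add_right)

lemma poly_op_diff: "poly_op (p - q) A = poly_op p A - poly_op q A"
  using poly_op_add[of "p - q" q A] by simp

lemma poly_op_mult: "poly_op (p * q) A = poly_op p A o\<^sub>L poly_op q A"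
  by (induction p)
    (simp_all add: poly_op_pCons poly_op_add poly_op_smult compose.add_left compose.scaleR_left
      blinfun_compose_assoc)

lemma poly_op_commute: "poly_op p A o\<^sub>L poly_op q A = poly_op q A o\<^sub>L poly_op p A"
  by (simp add: poly_op_mult[symmetric] mult.commute)

lemma self_adjoint_poly_op [op_closed]:
  assumes "self_adjoint A"
  shows "self_adjoint (poly_op p A)"
proof (induction p)
  case (pCons a p)
  have "A o\<^sub>L poly_op p A = poly_op p A o\<^sub>L A"
    using poly_op_commute[of "[:0, 1:]" A p] by (simp only: poly_op_X)
  then show ?case
    using pCons assms by (simp add: poly_op_pCons op_closed self_adjoint_commuting)
qed (simp add: op_closed)

lemma poly_op_eq_cpoly_op: "poly_op p A = cpoly_op (map_poly complex_of_real p) A"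
  by (induction p) (simp_all add: poly_op_pCons cpoly_op_pCons map_poly_pCons scalar_op_of_real)

lemma poly_map_poly_of_real:
  "poly (map_poly complex_of_real p) (complex_of_real t) = complex_of_real (poly p t)"
  by (induction p) (simp_all add: map_poly_pCons)

section \<open>Spectrum and norm of a real polynomial in an operator\<close>

definition real_spectrum :: "('a::complex_hilbert \<Rightarrow>\<^sub>L 'a) \<Rightarrow> real set"
  where "real_spectrum A = {t. complex_of_real t \<in> op_spectrum A}"

text \<open>Real zeros of \<open>q\<close> avoid the spectrum by hypothesis, non-real ones because
  the spectrum of a self-adjoint operator is real.\<close>

lemma poly_op_invertible:
  assumes A: "self_adjoint A" and q: "q \<noteq> 0" "\<And>t. t \<in> real_spectrum A \<Longrightarrow> poly q t \<noteq> 0"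
  shows "invertible_op (poly_op q A)"
  unfolding poly_op_eq_cpoly_op
proof (rule cpoly_op_invertible)
  show "A \<in> bounded_ops" using A by (rule self_adjoint_bounded_ops)
  show "map_poly complex_of_real q \<noteq> 0" using q by (simp add: map_poly_eq_0_iff)
  fix z assume z: "poly (map_poly complex_of_real q) z = 0"
  show "invertible_op (A - scalar_op z)"
  proof (cases "Im z = 0")
    case True
    then have zr: "z = complex_of_real (Re z)" by (simp add: complex_eq_iff)
    then have "poly q (Re z) = 0"
      using z by (metis of_real_eq_0_iff poly_map_poly_of_real)
    then have "Re z \<notin> real_spectrum A" using q by blast
    then show ?thesis
      using zr by (simp add: real_spectrum_def op_spectrum_def)
  qed (rule self_adjoint_spectrum_real[OF A])
qed

text \<open>\<open>N\<^sup>2 - p(A)\<^sup>2\<close> is positive but not bounded below when \<open>N = \<parallel>p(A)\<parallel>\<close>, hence not invertible.\<close>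

lemma norm_poly_op_attained:
  fixes A :: "'a::complex_hilbert \<Rightarrow>\<^sub>L 'a"
  assumes A: "self_adjoint A" and N: "N = norm (poly_op p A)" and nz: "poly_op p A \<noteq> 0"
    and q: "[:N\<^sup>2:] - p * p \<noteq> 0"
  shows "\<exists>t\<in>real_spectrum A. \<bar>poly p t\<bar> = N"
proof (rule ccontr)
  assume no: "\<not> ?thesis"
  define S where "S = poly_op p A"
  define Q where "Q = poly_op ([:N\<^sup>2:] - p * p) A"
  have S: "self_adjoint S" unfolding S_def by (rule self_adjoint_poly_op[OF A])
  have N0: "N > 0" using nz N by simp
  have "invertible_op Q"
    unfolding Q_def
  proof (rule poly_op_invertible[OF A q])
    fix t assume "t \<in> real_spectrum A"
    then have "\<bar>poly p t\<bar> \<noteq> N" using no by blast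
    then have "(poly p t)\<^sup>2 \<noteq> N\<^sup>2"
      using N0 by (metis abs_of_pos power2_eq_iff abs_minus_cancel)
    then show "poly ([:N\<^sup>2:] - p * p) t \<noteq> 0"
      by (simp add: power2_eq_square)
  qed
  have Qx: "rinner x (Q x) = N\<^sup>2 * (norm x)\<^sup>2 - (norm (S x))\<^sup>2" for x
    using self_adjoint_apply[OF S, of x "S x"]
    by (simp add: Q_def S_def poly_op_diff poly_op_const poly_op_mult blinfun.diff_left
        blinfun.scaleR_left rinner.diff_right rinner.scaleR_right rinner_self)
  have "0 \<le> rinner x (Q x)" for x
  proof -
    have "(norm (S x))\<^sup>2 \<le> (N * norm x)\<^sup>2"
      unfolding N S_def by (intro power_mono norm_blinfun) simp
    then show ?thesis by (simp add: Qx power_mult_distrib)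
  qed
  then have "Q \<in> pos_def"
    using \<open>invertible_op Q\<close> A by (simp add: pos_def_def pos_semidef_iff Q_def op_closed)
  then obtain c where c: "c > 0" "\<And>x. c * (norm x)\<^sup>2 \<le> rinner x (Q x)"
    using pos_def_bounded_below by blast
  \<comment> \<open>A lower bound \<open>c\<close> for \<open>Q\<close> means
    \<open>|S x|^2 \<le> (N^2 - c) * |x|^2\<close>; the minimum keeps the radicand below
    nonnegative.\<close>
  define d where "d = min c (N\<^sup>2)"
  have d: "d > 0" "d \<le> N\<^sup>2" "d \<le> c" using c N0 by (auto simp: d_def)
  have "norm (S x) \<le> sqrt (N\<^sup>2 - d) * norm x" for x
  proof (rule power2_le_imp_le)
    have "d * (norm x)\<^sup>2 \<le> c * (norm x)\<^sup>2"
      using d by (intro mult_right_mono) auto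
    then show "(norm (S x))\<^sup>2 \<le> (sqrt (N\<^sup>2 - d) * norm x)\<^sup>2"
      using c(2)[of x] d by (simp add: Qx power_mult_distrib algebra_simps)
  qed (use d in simp)
  then have "norm S \<le> sqrt (N\<^sup>2 - d)"
    using d by (intro norm_blinfun_bound) auto
  then have "N\<^sup>2 \<le> N\<^sup>2 - d"
    using N0 d unfolding N S_def[symmetric] by (simp add: real_le_rsqrt sqrt_ge_absD)
  with d show False by simp
qed

text \<open>The hypothesis on \<open>p\<close> excludes the zero space, where every operator is
  invertible and the spectrum is empty. For \<open>A \<noteq> 0\<close> the norm of \<open>A\<close>
  is attained in absolute value on the spectrum, by the polynomial \<open>[:0, 1:]\<close>; the zero
  operator has 0 in its spectrum.\<close>

lemma real_spectrum_nonempty: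
  fixes A :: "'a::complex_hilbert \<Rightarrow>\<^sub>L 'a"
  assumes A: "self_adjoint A" and nz: "poly_op p A \<noteq> 0"
  shows "real_spectrum A \<noteq> {}"
proof (cases "A = 0")
  case False
  define N where "N = norm A"
  have "coeff ([:N\<^sup>2:] - [:0, 1:] * [:0, 1:]) 2 = -1"
    by (simp add: numeral_2_eq_2)
  then have "[:N\<^sup>2:] - [:0, 1:] * [:0, 1:] \<noteq> 0"
    by (metis coeff_0 zero_neq_neg_one)
  then show ?thesis
    using norm_poly_op_attained[OF A, of N "[:0, 1:]"] False by (auto simp: poly_op_X N_def)
next
  case True
  obtain x where x: "poly_op p A x \<noteq> 0"
    using nz by (metis blinfun_eqI blinfun.zero_left)
  then have "x \<noteq> 0" by (metis blinfun.zero_right)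
  then have "(id_blinfun :: 'a \<Rightarrow>\<^sub>L 'a) \<noteq> 0"
    by (metis blinfun_apply_id_blinfun blinfun.zero_left id_apply)
  then have "\<not> invertible_op (A - scalar_op (complex_of_real 0))"
    using True by (simp add: invertible_op_def)
  then have "0 \<in> real_spectrum A"
    unfolding real_spectrum_def op_spectrum_def by blast
  then show ?thesis by blast
qed

text \<open>A norm \<open>N\<close> larger than \<open>b\<close> would be a value of
  \<open>|p|\<close> on the spectrum. To use this, \<open>N^2 - p^2\<close> must be a nonzero
  polynomial, and any point of the spectrum witnesses that.\<close>

lemma norm_poly_op_le:
  assumes A: "self_adjoint A" and b: "0 \<le> b" "\<And>t. t \<in> real_spectrum A \<Longrightarrow> \<bar>poly p t\<bar> \<le> b"
  shows "norm (poly_op p A) \<le> b"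
proof (rule ccontr)
  assume not: "\<not> ?thesis"
  define N where "N = norm (poly_op p A)"
  have N: "N > b" "poly_op p A \<noteq> 0" using not b by (auto simp: N_def)
  obtain t where t: "t \<in> real_spectrum A"
    using real_spectrum_nonempty[OF A N(2)] by blast
  have "poly ([:N\<^sup>2:] - p * p) t \<noteq> 0"
  proof -
    have "(poly p t)\<^sup>2 < N\<^sup>2"
      using b(2)[OF t] N b(1) by (intro power2_strict_mono) simp
    then show ?thesis by (simp add: power2_eq_square)
  qed
  then have "[:N\<^sup>2:] - p * p \<noteq> 0" by (metis poly_0)
  then show False
    using norm_poly_op_attained[OF A N_def N(2)] b N by fastforce
qed

section \<open>Continuous functional calculus and real powers\<close>

text \<open>The norm bound for polynomials survives the limit. With \<open>e = 0\<close> it shows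
  that the limit does not depend on the approximating sequence; with small \<open>e\<close> it makes
  powers continuous in the exponent.\<close>

lemma norm_calculus_le:
  assumes A: "self_adjoint A" and e: "0 \<le> e"
    and p: "uniform_limit (real_spectrum A) (\<lambda>n. poly (p n)) f sequentially"
      "(\<lambda>n. poly_op (p n) A) \<longlonglongrightarrow> S"
    and q: "uniform_limit (real_spectrum A) (\<lambda>n. poly (q n)) g sequentially"
      "(\<lambda>n. poly_op (q n) A) \<longlonglongrightarrow> T"
    and fg: "\<And>t. t \<in> real_spectrum A \<Longrightarrow> \<bar>f t - g t\<bar> \<le> e"
  shows "norm (S - T) \<le> e"
proof (rule field_le_epsilon)
  fix d :: real assume d: "d > 0"
  have d2: "d / 2 > 0" using d by simp
  have "\<forall>\<^sub>F n in sequentially. norm (poly_op (p n) A - poly_op (q n) A) \<le> e + d"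
    using uniform_limitD[OF p(1) d2] uniform_limitD[OF q(1) d2]
  proof eventually_elim
    case (elim n)
    have "norm (poly_op (p n - q n) A) \<le> e + d"
    proof (rule norm_poly_op_le[OF A])
      fix t assume t: "t \<in> real_spectrum A"
      have "\<bar>poly (p n) t - f t\<bar> < d / 2" "\<bar>poly (q n) t - g t\<bar> < d / 2"
        using elim t by (auto simp: dist_real_def)
      then show "\<bar>poly (p n - q n) t\<bar> \<le> e + d"
        using fg[OF t] unfolding poly_diff by linarith
    qed (use e d in simp)
    then show ?case by (simp add: poly_op_diff)
  qed
  moreover have "(\<lambda>n. norm (poly_op (p n) A - poly_op (q n) A)) \<longlonglongrightarrow> norm (S - T)"
    by (intro tendsto_intros p q)
  ultimately show "norm (S - T) \<le> e + d"
    by (intro tendsto_upperbound) auto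
qed

lemma convergent_poly_op:
  assumes A: "self_adjoint A"
    and p: "uniform_limit (real_spectrum A) (\<lambda>n. poly (p n)) f sequentially"
  shows "convergent (\<lambda>n. poly_op (p n) A)"
proof (rule Cauchy_convergent, rule metric_CauchyI)
  fix e :: real assume e: "e > 0"
  obtain N where N: "\<And>n t. n \<ge> N \<Longrightarrow> t \<in> real_spectrum A \<Longrightarrow> dist (poly (p n) t) (f t) < e / 4"
    using uniform_limitD[OF p, of "e / 4"] e by (auto simp: eventually_sequentially)
  show "\<exists>M. \<forall>m\<ge>M. \<forall>n\<ge>M. dist (poly_op (p m) A) (poly_op (p n) A) < e"
  proof (intro exI[of _ N] allI impI)
    fix m n assume mn: "m \<ge> N" "n \<ge> N"
    have "norm (poly_op (p m - p n) A) \<le> e / 2"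
    proof (rule norm_poly_op_le[OF A])
      fix t assume t: "t \<in> real_spectrum A"
      show "\<bar>poly (p m - p n) t\<bar> \<le> e / 2"
        using N[OF mn(1) t] N[OF mn(2) t] unfolding dist_real_def poly_diff by linarith
    qed (use e in simp)
    then show "dist (poly_op (p m) A) (poly_op (p n) A) < e"
      using e by (simp add: poly_op_diff dist_norm)
  qed
qed

lemma fun_calc_limit:
  assumes A: "self_adjoint A"
    and p: "uniform_limit (real_spectrum A) (\<lambda>n. poly (p n)) f sequentially"
  shows "(\<lambda>n. poly_op (p n) A) \<longlonglongrightarrow> fun_calc f A"
proof -
  obtain T where T: "(\<lambda>n. poly_op (p n) A) \<longlonglongrightarrow> T"
    using convergent_poly_op[OF A p] by (auto simp: convergent_def)
  have "fun_calc f A = T"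
    unfolding fun_calc_def real_spectrum_def[symmetric]
  proof (rule the_equality)
    show "\<forall>q. uniform_limit (real_spectrum A) (\<lambda>n. poly (q n)) f sequentially \<longrightarrow>
      (\<lambda>n. poly_op (q n) A) \<longlonglongrightarrow> T"
    proof (intro allI impI)
      fix q assume q: "uniform_limit (real_spectrum A) (\<lambda>n. poly (q n)) f sequentially"
      then obtain S where S: "(\<lambda>n. poly_op (q n) A) \<longlonglongrightarrow> S"
        using convergent_poly_op[OF A q] by (auto simp: convergent_def)
      have "norm (S - T) \<le> 0"
        by (rule norm_calculus_le[OF A _ q S p T]) auto
      then show "(\<lambda>n. poly_op (q n) A) \<longlonglongrightarrow> T" using S by simp
    qed
  next
    \<comment> \<open>Uniqueness rests on the given sequence \<open>p\<close>: without any
      approximating sequence, the defining condition would hold vacuously for every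
      operator.\<close>
    fix S assume "\<forall>q. uniform_limit (real_spectrum A) (\<lambda>n. poly (q n)) f sequentially \<longrightarrow>
      (\<lambda>n. poly_op (q n) A) \<longlonglongrightarrow> S"
    then show "S = T" using p T LIMSEQ_unique by blast
  qed
  with T show ?thesis by simp
qed

lemma polynomial_approximation:
  fixes f :: "real \<Rightarrow> real"
  assumes "compact K" "continuous_on K f"
  obtains p where "uniform_limit K (\<lambda>n. poly (p n)) f sequentially"
proof -
  have "\<exists>p. \<forall>t\<in>K. \<bar>f t - poly p t\<bar> < 1 / real (Suc n)" for n
  proof -
    obtain g where g: "real_polynomial_function g" "\<And>t. t \<in> K \<Longrightarrow> \<bar>f t - g t\<bar> < 1 / real (Suc n)"
      using Stone_Weierstrass_real_polynomial_function[OF assms, of "1 / real (Suc n)"] by auto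
    obtain a m where "g = (\<lambda>t. \<Sum>i\<le>m. a i * t ^ i)"
      using g(1) by (auto simp: real_polynomial_function_iff_sum)
    then have "poly (\<Sum>i\<le>m. monom (a i) i) t = g t" for t
      by (simp add: poly_sum poly_monom)
    then show ?thesis using g(2) by (intro exI[of _ "\<Sum>i\<le>m. monom (a i) i"]) simp
  qed
  then obtain p where p: "\<And>n t. t \<in> K \<Longrightarrow> \<bar>f t - poly (p n) t\<bar> < 1 / real (Suc n)"
    by metis
  have "uniform_limit K (\<lambda>n. poly (p n)) f sequentially"
  proof (rule uniform_limitI)
    fix e :: real assume "e > 0"
    then obtain N where N: "inverse (real (Suc N)) < e"
      using reals_Archimedean by blast
    have "dist (poly (p n) t) (f t) < e" if "n \<ge> N" "t \<in> K" for n t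
    proof -
      have "1 / real (Suc n) \<le> 1 / real (Suc N)"
        using that by (intro divide_left_mono) auto
      then show ?thesis
        using p[OF that(2), of n] N by (simp add: dist_real_def abs_minus_commute inverse_eq_divide)
    qed
    then show "\<forall>\<^sub>F n in sequentially. \<forall>t\<in>K. dist (poly (p n) t) (f t) < e"
      by (auto simp: eventually_sequentially)
  qed
  then show thesis by (rule that)
qed

text \<open>Outside the interval from \<open>c\<close> to \<open>norm A\<close>, either
  \<open>A - t\<close> or \<open>t - A\<close> is bounded below. The compact interval stays away
  from 0, so powers are continuous on it, and approximations made there restrict to the
  spectrum.\<close>

lemma pos_def_real_spectrum:
  assumes A: "A \<in> pos_def"
  obtains c M where "0 < c" "real_spectrum A \<subseteq> {c..M}"
proof -
  have sa: "self_adjoint A" using A by (rule pos_def_self_adjoint)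
  obtain c where c: "c > 0" "\<And>x. c * (norm x)\<^sup>2 \<le> rinner x (A x)"
    using pos_def_bounded_below[OF A] by blast
  have up: "rinner x (A x) \<le> norm A * (norm x)\<^sup>2" for x
  proof -
    have "rinner x (A x) \<le> norm x * (norm A * norm x)"
      using abs_rinner_le[of x "A x"] mult_left_mono[OF norm_blinfun[of A x] norm_ge_zero[of x]]
      by linarith
    then show ?thesis by (simp add: power2_eq_square ac_simps)
  qed
  have "t \<in> {c..norm A}" if t: "t \<in> real_spectrum A" for t
  proof (rule ccontr)
    assume "t \<notin> {c..norm A}"
    then consider "t < c" | "t > norm A" by force
    then have "invertible_op (A - t *\<^sub>R id_blinfun)"
    proof cases
      case 1
      then show ?thesis
        using sa c(2) by (intro bounded_below_invertible[of _ "c - t"])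
          (auto simp: op_closed blinfun.diff_left blinfun.scaleR_left rinner_simps algebra_simps)
    next
      case 2
      then have "invertible_op (t *\<^sub>R id_blinfun - A)"
        using sa up by (intro bounded_below_invertible[of _ "t - norm A"])
          (auto simp: op_closed blinfun.diff_left blinfun.scaleR_left rinner_simps algebra_simps)
      from invertible_uminus[OF this] show ?thesis by simp
    qed
    then show False
      using t by (simp add: real_spectrum_def op_spectrum_def scalar_op_of_real)
  qed
  then show thesis using c(1) by (intro that[of c "norm A"]) auto
qed

section \<open>Real powers of positive definite operators\<close>

lemma continuous_on_powr_const:
  "0 < c \<Longrightarrow> continuous_on {c..M} (\<lambda>t::real. t powr s)"
  by (intro continuous_intros) auto

lemma op_powr_approximation:
  assumes A: "A \<in> pos_def"
  obtains p where "uniform_limit (real_spectrum A) (\<lambda>n. poly (p n)) (\<lambda>t. t powr s) sequentially"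
    "(\<lambda>n. poly_op (p n) A) \<longlonglongrightarrow> op_powr A s"
proof -
  obtain c M where cM: "0 < c" "real_spectrum A \<subseteq> {c..M}"
    using pos_def_real_spectrum[OF A] by blast
  obtain p where "uniform_limit {c..M} (\<lambda>n. poly (p n)) (\<lambda>t. t powr s) sequentially"
    using polynomial_approximation[OF compact_Icc continuous_on_powr_const[OF cM(1)]] by blast
  then have p: "uniform_limit (real_spectrum A) (\<lambda>n. poly (p n)) (\<lambda>t. t powr s) sequentially"
    using cM(2) by (rule uniform_limit_on_subset)
  with fun_calc_limit[OF pos_def_self_adjoint[OF A] p] show thesis
    unfolding op_powr_def[symmetric] by (intro that[of p])
qed

lemma op_powr_eqI:
  assumes A: "A \<in> pos_def"
    and p: "uniform_limit (real_spectrum A) (\<lambda>n. poly (p n)) (\<lambda>t. t powr s) sequentially"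
      "(\<lambda>n. poly_op (p n) A) \<longlonglongrightarrow> T"
  shows "op_powr A s = T"
  using fun_calc_limit[OF pos_def_self_adjoint[OF A] p(1)] p(2) LIMSEQ_unique
  unfolding op_powr_def by blast

lemma self_adjoint_op_powr [op_closed]:
  assumes A: "A \<in> pos_def"
  shows "self_adjoint (op_powr A s)"
proof -
  obtain p where "(\<lambda>n. poly_op (p n) A) \<longlonglongrightarrow> op_powr A s"
    using op_powr_approximation[OF A] by metis
  then show ?thesis
    by (rule self_adjoint_limit[rotated])
      (rule self_adjoint_poly_op[OF pos_def_self_adjoint[OF A]])
qed

lemma op_powr_add:
  assumes A: "A \<in> pos_def"
  shows "op_powr A s o\<^sub>L op_powr A t = op_powr A (s + t)"
proof -
  obtain c M where cM: "0 < c" "real_spectrum A \<subseteq> {c..M}"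
    using pos_def_real_spectrum[OF A] by blast
  \<comment> \<open>Boundedness of both limit functions makes the products of the approximations
    converge uniformly.\<close>
  have bdd: "bounded ((\<lambda>t. t powr r) ` real_spectrum A)" for r
    using compact_imp_bounded[OF compact_continuous_image[OF continuous_on_powr_const[OF cM(1)] compact_Icc]]
      image_mono[OF cM(2)] by (rule bounded_subset)
  obtain p where p: "uniform_limit (real_spectrum A) (\<lambda>n. poly (p n)) (\<lambda>t. t powr s) sequentially"
    "(\<lambda>n. poly_op (p n) A) \<longlonglongrightarrow> op_powr A s"
    using op_powr_approximation[OF A] by metis
  obtain q where q: "uniform_limit (real_spectrum A) (\<lambda>n. poly (q n)) (\<lambda>x. x powr t) sequentially"
    "(\<lambda>n. poly_op (q n) A) \<longlonglongrightarrow> op_powr A t"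
    using op_powr_approximation[OF A] by metis
  have "uniform_limit (real_spectrum A) (\<lambda>n x. poly (p n) x * poly (q n) x)
      (\<lambda>x. x powr s * x powr t) sequentially"
    using bounded_bilinear.bounded_uniform_limit[OF bounded_bilinear_mult p(1) q(1) bdd bdd] .
  then have "uniform_limit (real_spectrum A) (\<lambda>n. poly (p n * q n)) (\<lambda>x. x powr (s + t)) sequentially"
    by (simp add: powr_add poly_mult[abs_def])
  moreover have "(\<lambda>n. poly_op (p n * q n) A) \<longlonglongrightarrow> (op_powr A s o\<^sub>L op_powr A t)"
    unfolding poly_op_mult by (intro compose.tendsto p q)
  ultimately show ?thesis
    using op_powr_eqI[OF A] by metis
qed

lemma op_powr_0:
  assumes A: "A \<in> pos_def"
  shows "op_powr A 0 = id_blinfun"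
proof (rule op_powr_eqI[OF A, of "\<lambda>_. [:1:]"])
  obtain c M where cM: "0 < c" "real_spectrum A \<subseteq> {c..M}"
    using pos_def_real_spectrum[OF A] by blast
  \<comment> \<open>Since \<open>0 powr 0\<close> is 0, the constant polynomial 1 agrees with the
    power of exponent 0 only away from 0.\<close>
  then have "0 \<notin> real_spectrum A" by auto
  then show "uniform_limit (real_spectrum A) (\<lambda>n. poly [:1:]) (\<lambda>t. t powr 0) sequentially"
    by (auto intro!: uniform_limitI always_eventually)
qed (simp add: poly_op_const)

lemma op_powr_1:
  assumes A: "A \<in> pos_def"
  shows "op_powr A 1 = A"
proof (rule op_powr_eqI[OF A, of "\<lambda>_. [:0, 1:]"])
  obtain c M where cM: "0 < c" "real_spectrum A \<subseteq> {c..M}"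
    using pos_def_real_spectrum[OF A] by blast
  then have "t > 0" if "t \<in> real_spectrum A" for t using that by fastforce
  then show "uniform_limit (real_spectrum A) (\<lambda>n. poly [:0, 1:]) (\<lambda>t. t powr 1) sequentially"
    by (auto intro!: uniform_limitI always_eventually simp: less_imp_le)
qed (simp add: poly_op_X)

lemma op_powr_pos_def [op_closed]:
  assumes A: "A \<in> pos_def"
  shows "op_powr A s \<in> pos_def"
proof -
  have "op_powr A s = op_powr A (s / 2) o\<^sub>L op_powr A (s / 2)"
    by (simp add: op_powr_add[OF A])
  then have "pos_semidef (op_powr A s)"
    using pos_semidef_square[OF self_adjoint_op_powr[OF A]] by simp
  moreover have "invertible_op (op_powr A s)"
    unfolding invertible_op_def
    by (intro bexI[of _ "op_powr A (- s)"])
      (simp_all add: op_powr_add[OF A] op_powr_0[OF A] self_adjoint_bounded_ops self_adjoint_op_powr[OF A])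
  ultimately show ?thesis by (simp add: pos_def_def)
qed

text \<open>On a compact rectangle of bases and exponents \<open>powr\<close> is uniformly
  continuous, so nearby exponents give functions that are uniformly close on the spectrum. The
  exponent side has radius 1 around \<open>s\<close>, whence the tolerance
  \<open>min d 1\<close>.\<close>

lemma op_powr_tendsto:
  assumes A: "A \<in> pos_def" and r: "r \<longlonglongrightarrow> s"
  shows "(\<lambda>n. op_powr A (r n)) \<longlonglongrightarrow> op_powr A s"
proof (rule metric_LIMSEQ_I)
  fix e :: real assume e: "e > 0"
  obtain c M where cM: "0 < c" "real_spectrum A \<subseteq> {c..M}"
    using pos_def_real_spectrum[OF A] by blast
  define K where "K = {c..M} \<times> {s - 1..s + 1}"
  have "continuous_on K (\<lambda>z. fst z powr snd z)"
    using cM(1) unfolding K_def by (intro continuous_intros) auto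
  then have "uniformly_continuous_on K (\<lambda>z. fst z powr snd z)"
    unfolding K_def by (intro compact_uniformly_continuous compact_Times compact_Icc)
  then obtain d where d: "d > 0"
    "\<And>z w. z \<in> K \<Longrightarrow> w \<in> K \<Longrightarrow> dist w z < d \<Longrightarrow> dist (fst w powr snd w) (fst z powr snd z) < e / 2"
    unfolding uniformly_continuous_on_def using e by (metis half_gt_zero)
  obtain N where N: "\<And>n. n \<ge> N \<Longrightarrow> dist (r n) s < min d 1"
    using metric_LIMSEQ_D[OF r, of "min d 1"] d by auto
  show "\<exists>N. \<forall>n\<ge>N. dist (op_powr A (r n)) (op_powr A s) < e"
  proof (intro exI[of _ N] allI impI)
    fix n assume "n \<ge> N"
    then have n: "dist (r n) s < d" "dist (r n) s < 1" using N by auto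
    obtain p where p: "uniform_limit (real_spectrum A) (\<lambda>n. poly (p n)) (\<lambda>t. t powr r n) sequentially"
      "(\<lambda>n. poly_op (p n) A) \<longlonglongrightarrow> op_powr A (r n)"
      using op_powr_approximation[OF A] by metis
    obtain q where q: "uniform_limit (real_spectrum A) (\<lambda>n. poly (q n)) (\<lambda>t. t powr s) sequentially"
      "(\<lambda>n. poly_op (q n) A) \<longlonglongrightarrow> op_powr A s"
      using op_powr_approximation[OF A] by metis
    have "norm (op_powr A (r n) - op_powr A s) \<le> e / 2"
    proof (rule norm_calculus_le[OF pos_def_self_adjoint[OF A] _ p q])
      fix t assume "t \<in> real_spectrum A"
      then have "(t, r n) \<in> K" "(t, s) \<in> K"
        using cM n by (auto simp: K_def dist_real_def abs_less_iff)
      moreover have "dist (t, r n) (t, s) < d"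
        using n by (simp add: dist_Pair_Pair)
      ultimately show "\<bar>t powr r n - t powr s\<bar> \<le> e / 2"
        using d(2)[of "(t, s)" "(t, r n)"] by (simp add: dist_real_def)
    qed (use e in simp)
    then show "dist (op_powr A (r n)) (op_powr A s) < e"
      using e by (simp add: dist_norm)
  qed
qed

section \<open>Geometric means\<close>

lemma op_powr_apply:
  "A \<in> pos_def \<Longrightarrow> op_powr A s (op_powr A t x) = op_powr A (s + t) x"
  by (metis blinfun_apply_blinfun_compose op_powr_add)

lemma op_powr_inverse_apply:
  assumes "A \<in> pos_def"
  shows "op_powr A (- 1) (A x) = x" "A (op_powr A (- 1) x) = x"
proof -
  have "op_powr A (- 1) (op_powr A 1 x) = x" "op_powr A 1 (op_powr A (- 1) x) = x"
    using assms by (simp_all add: op_powr_apply op_powr_0)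
  then show "op_powr A (- 1) (A x) = x" "A (op_powr A (- 1) x) = x"
    using assms by (simp_all add: op_powr_1)
qed

lemma op_powr_inverse_eqI:
  assumes "A \<in> pos_def" "A o\<^sub>L T = id_blinfun"
  shows "op_powr A (- 1) = T"
proof (rule blinfun_eqI)
  fix x
  have "A (T x) = x" using assms(2) by (metis blinfun_apply_blinfun_compose blinfun_apply_id_blinfun id_apply)
  then show "op_powr A (- 1) x = T x"
    using op_powr_inverse_apply(1)[OF assms(1), of "T x"] by simp
qed

lemma pos_def_congruence [op_closed]:
  assumes "A \<in> pos_def" "T \<in> pos_def"
  shows "T o\<^sub>L A o\<^sub>L T \<in> pos_def"
  using assms by (simp add: pos_def_def invertible_compose pos_semidef_congruence pos_semidef_self_adjoint)

lemma pos_def_id [op_closed]: "id_blinfun \<in> pos_def"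
  by (auto simp: pos_def_iff_bounded_below op_closed rinner_self intro: exI[of _ 1])

lemma pos_def_square [op_closed]: "A \<in> pos_def \<Longrightarrow> A o\<^sub>L A \<in> pos_def"
  using pos_def_congruence[OF pos_def_id, of A] by simp

lemma loewner_le_congruence:
  "A \<le>\<^sub>L B \<Longrightarrow> self_adjoint T \<Longrightarrow> T o\<^sub>L A o\<^sub>L T \<le>\<^sub>L T o\<^sub>L B o\<^sub>L T"
  using pos_semidef_congruence[of "B - A" T]
  by (simp add: loewner_le_def compose.diff_left compose.diff_right)

lemma loewner_le_trans: "A \<le>\<^sub>L B \<Longrightarrow> B \<le>\<^sub>L C \<Longrightarrow> A \<le>\<^sub>L C"
  using pos_semidef_add[of "B - A" "C - B"] by (simp add: loewner_le_def)

lemma loewner_le_refl: "A \<le>\<^sub>L A"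
  by (simp add: loewner_le_def pos_semidef_iff op_closed rinner_simps)

text \<open>With \<open>V\<close> and \<open>U\<close> the inverses of \<open>X\<close> and
  \<open>Y\<close>, the identity \<open>V - U = (V - U) X (V - U) + U (Y - X) U\<close> displays the
  difference as a sum of two congruences of positive operators.\<close>

lemma inverse_antimono:
  assumes X: "X \<in> pos_def" and Y: "Y \<in> pos_def" and le: "X \<le>\<^sub>L Y"
  shows "op_powr Y (- 1) \<le>\<^sub>L op_powr X (- 1)"
proof -
  define U where "U = op_powr Y (- 1)"
  define V where "V = op_powr X (- 1)"
  note inv = op_powr_inverse_apply[OF X, folded V_def] op_powr_inverse_apply[OF Y, folded U_def]
  have sa: "self_adjoint U" "self_adjoint V"
    unfolding U_def V_def using X Y by (simp_all add: op_closed)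
  have "V - U = ((V - U) o\<^sub>L X o\<^sub>L (V - U)) + (U o\<^sub>L (Y - X) o\<^sub>L U)"
    by (rule blinfun_eqI)
      (simp add: blinfun.add_left blinfun.diff_left blinfun.diff_right blinfun.add_right inv)
  also have "pos_semidef \<dots>"
    using le unfolding loewner_le_def
    by (intro pos_semidef_add pos_semidef_congruence pos_def_pos_semidef[OF X] self_adjoint_diff sa)
  finally show ?thesis
    by (simp add: loewner_le_def U_def V_def)
qed

lemma wgeo_mean_pos_def [op_closed]:
  assumes "X \<in> pos_def" "Y \<in> pos_def"
  shows "wgeo_mean X s Y \<in> pos_def"
  unfolding wgeo_mean_def by (intro pos_def_congruence op_powr_pos_def assms)

lemma geo_mean_pos_def [op_closed]: "X \<in> pos_def \<Longrightarrow> Y \<in> pos_def \<Longrightarrow> X #\<^sub>m Y \<in> pos_def"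
  unfolding geo_mean_def by (rule wgeo_mean_pos_def)

lemma geo_mean_riccati:
  assumes X: "X \<in> pos_def" and Y: "Y \<in> pos_def"
  shows "(X #\<^sub>m Y) o\<^sub>L op_powr X (- 1) o\<^sub>L (X #\<^sub>m Y) = Y"
proof (rule blinfun_eqI)
  fix x
  define C where "C = op_powr X (- (1/2)) o\<^sub>L Y o\<^sub>L op_powr X (- (1/2))"
  have C: "C \<in> pos_def" unfolding C_def by (intro pos_def_congruence op_powr_pos_def X Y)
  have Cx: "C z = op_powr X (- (1/2)) (Y (op_powr X (- (1/2)) z))" for z
    by (simp add: C_def)
  have "((X #\<^sub>m Y) o\<^sub>L op_powr X (- 1) o\<^sub>L (X #\<^sub>m Y)) x
      = op_powr X (1/2) (op_powr C (1/2) (op_powr C (1/2) (op_powr X (1/2) x)))"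
    by (simp add: geo_mean_def wgeo_mean_def C_def[symmetric] op_powr_apply[OF X] op_powr_0[OF X])
  also have "\<dots> = op_powr X (1/2) (C (op_powr X (1/2) x))"
    by (simp add: op_powr_apply[OF C] op_powr_1[OF C])
  also have "\<dots> = Y x"
    by (simp add: Cx op_powr_apply[OF X] op_powr_0[OF X])
  finally show "((X #\<^sub>m Y) o\<^sub>L op_powr X (- 1) o\<^sub>L (X #\<^sub>m Y)) x = Y x" .
qed

text \<open>Let \<open>Q = X^(-1/2)\<close>. Since \<open>Q Q = X^-1\<close>, congruence by
  \<open>Q\<close> turns the Riccati equation into \<open>(Q H Q)^2 = Q Y Q\<close>, and the
  positive definite square root is unique.\<close>

lemma geo_mean_eqI:
  assumes X: "X \<in> pos_def" and H: "H \<in> pos_def" and eq: "H o\<^sub>L op_powr X (- 1) o\<^sub>L H = Y"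
  shows "X #\<^sub>m Y = H"
proof -
  define Q where "Q = op_powr X (-1/2)"
  define C where "C = Q o\<^sub>L Y o\<^sub>L Q"
  have Q: "Q \<in> pos_def" unfolding Q_def by (rule op_powr_pos_def[OF X])
  have "Y \<in> pos_def"
    unfolding eq[symmetric] by (intro pos_def_congruence op_powr_pos_def X H)
  then have C: "C \<in> pos_def"
    unfolding C_def by (intro pos_def_congruence Q)
  have "op_powr C (1/2) = Q o\<^sub>L H o\<^sub>L Q"
  proof (rule pos_def_square_root_unique)
    show "op_powr C (1/2) \<in> pos_def" by (rule op_powr_pos_def[OF C])
    show "Q o\<^sub>L H o\<^sub>L Q \<in> pos_def" by (intro pos_def_congruence Q H)
    have "op_powr C (1/2) o\<^sub>L op_powr C (1/2) = C"
      by (simp add: op_powr_add[OF C] op_powr_1[OF C])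
    also have "\<dots> = (Q o\<^sub>L H o\<^sub>L Q) o\<^sub>L (Q o\<^sub>L H o\<^sub>L Q)"
      by (rule blinfun_eqI) (simp add: C_def eq[symmetric] Q_def op_powr_apply[OF X])
    finally show "op_powr C (1/2) o\<^sub>L op_powr C (1/2) = (Q o\<^sub>L H o\<^sub>L Q) o\<^sub>L (Q o\<^sub>L H o\<^sub>L Q)" .
  qed
  then have "X #\<^sub>m Y = op_powr X (1/2) o\<^sub>L (Q o\<^sub>L H o\<^sub>L Q) o\<^sub>L op_powr X (1/2)"
    by (simp add: geo_mean_def wgeo_mean_def C_def Q_def)
  also have "\<dots> = H"
    by (rule blinfun_eqI) (simp add: Q_def op_powr_apply[OF X] op_powr_0[OF X])
  finally show ?thesis .
qed

text \<open>For the means \<open>G\<close> and \<open>H\<close>, the Riccati equations and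
  antitonicity of the inverse give \<open>G X^-1 G = Y \<le> Y' = H X'^-1 H \<le> H X^-1 H\<close>.
  Both ends now involve the same \<open>X\<close>, so congruence by \<open>R = X^(-1/2)\<close>
  makes them the squares of \<open>R G R\<close> and \<open>R H R\<close>.\<close>

lemma geo_mean_mono:
  assumes X: "X \<in> pos_def" "X' \<in> pos_def" "X \<le>\<^sub>L X'" and Y: "Y \<in> pos_def" "Y' \<in> pos_def" "Y \<le>\<^sub>L Y'"
  shows "X #\<^sub>m Y \<le>\<^sub>L X' #\<^sub>m Y'"
proof -
  define G where "G = X #\<^sub>m Y"
  define H where "H = X' #\<^sub>m Y'"
  define R where "R = op_powr X (-1/2)"
  have GH: "G \<in> pos_def" "H \<in> pos_def" and R: "R \<in> pos_def"
    unfolding G_def H_def R_def using X Y by (simp_all add: op_closed)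
  note sa = pos_def_self_adjoint[OF GH(1)] pos_def_self_adjoint[OF GH(2)] pos_def_self_adjoint[OF R]
  have "H o\<^sub>L op_powr X' (- 1) o\<^sub>L H \<le>\<^sub>L H o\<^sub>L op_powr X (- 1) o\<^sub>L H"
    by (intro loewner_le_congruence inverse_antimono X sa)
  then have "Y' \<le>\<^sub>L H o\<^sub>L op_powr X (- 1) o\<^sub>L H"
    using geo_mean_riccati[OF X(2) Y(2)] by (simp add: H_def)
  with Y(3) have "Y \<le>\<^sub>L H o\<^sub>L op_powr X (- 1) o\<^sub>L H"
    by (rule loewner_le_trans)
  then have "G o\<^sub>L op_powr X (- 1) o\<^sub>L G \<le>\<^sub>L H o\<^sub>L op_powr X (- 1) o\<^sub>L H"
    using geo_mean_riccati[OF X(1) Y(1)] by (simp add: G_def)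
  then have le: "R o\<^sub>L (G o\<^sub>L op_powr X (- 1) o\<^sub>L G) o\<^sub>L R \<le>\<^sub>L R o\<^sub>L (H o\<^sub>L op_powr X (- 1) o\<^sub>L H) o\<^sub>L R"
    by (rule loewner_le_congruence) (rule sa)
  have sq: "R o\<^sub>L (T o\<^sub>L op_powr X (- 1) o\<^sub>L T) o\<^sub>L R = (R o\<^sub>L T o\<^sub>L R) o\<^sub>L (R o\<^sub>L T o\<^sub>L R)" for T
    by (rule blinfun_eqI) (simp add: R_def op_powr_apply[OF X(1)])
  have "R o\<^sub>L G o\<^sub>L R \<le>\<^sub>L R o\<^sub>L H o\<^sub>L R"
    using le unfolding sq loewner_le_def
    by (rule square_le_imp_le[rotated 2]) (use GH R in \<open>simp_all add: pos_def_congruence pos_def_pos_semidef\<close>)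
  then have "op_powr X (1/2) o\<^sub>L (R o\<^sub>L G o\<^sub>L R) o\<^sub>L op_powr X (1/2)
      \<le>\<^sub>L op_powr X (1/2) o\<^sub>L (R o\<^sub>L H o\<^sub>L R) o\<^sub>L op_powr X (1/2)"
    by (rule loewner_le_congruence) (rule self_adjoint_op_powr[OF X(1)])
  moreover have "op_powr X (1/2) o\<^sub>L (R o\<^sub>L T o\<^sub>L R) o\<^sub>L op_powr X (1/2) = T" for T
    by (rule blinfun_eqI) (simp add: R_def op_powr_apply[OF X(1)] op_powr_0[OF X(1)])
  ultimately show ?thesis by (simp add: G_def H_def)
qed

text \<open>
  The case of exponent 2 of the Ando--Hiai inequality. If \<open>G = X # Y \<le> I\<close>, then \<open>G\<close> is also the
  mean of the larger operators \<open>X G\<inverse> X \<ge> X\<^sup>2\<close> and \<open>G X\<inverse> G X\<inverse> G \<ge> Y\<^sup>2\<close>.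
\<close>

lemma geo_mean_square_le_id:
  fixes X Y :: "'a::complex_hilbert \<Rightarrow>\<^sub>L 'a"
  assumes X: "X \<in> pos_def" and Y: "Y \<in> pos_def" and le: "X #\<^sub>m Y \<le>\<^sub>L id_blinfun"
  shows "(X o\<^sub>L X) #\<^sub>m (Y o\<^sub>L Y) \<le>\<^sub>L id_blinfun"
proof -
  define G where "G = X #\<^sub>m Y"
  define V where "V = op_powr X (- 1)"
  define U where "U = op_powr G (- 1)"
  have pd: "G \<in> pos_def" "V \<in> pos_def" "U \<in> pos_def"
    unfolding G_def V_def U_def using X Y by (simp_all add: op_closed)
  note sa = pd[THEN pos_def_self_adjoint] X[THEN pos_def_self_adjoint]
  note inv = op_powr_inverse_apply[OF X, folded V_def] op_powr_inverse_apply[OF pd(1), folded U_def]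
  have GI: "G \<le>\<^sub>L id_blinfun" using le by (simp add: G_def)
  have "op_powr id_blinfun (- 1) = (id_blinfun :: 'a \<Rightarrow>\<^sub>L 'a)"
    by (rule op_powr_inverse_eqI[OF pos_def_id]) simp
  then have "id_blinfun \<le>\<^sub>L U"
    using inverse_antimono[OF pd(1) pos_def_id GI] by (simp add: U_def)
  then have XX: "X o\<^sub>L X \<le>\<^sub>L X o\<^sub>L U o\<^sub>L X"
    using loewner_le_congruence[of id_blinfun U X] sa by simp
  have GG: "G o\<^sub>L G \<le>\<^sub>L G"
  proof -
    have "op_powr G (1/2) o\<^sub>L G o\<^sub>L op_powr G (1/2) \<le>\<^sub>L op_powr G (1/2) o\<^sub>L id_blinfun o\<^sub>L op_powr G (1/2)"
      by (intro loewner_le_congruence GI self_adjoint_op_powr pd)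
    moreover have "op_powr G (1/2) o\<^sub>L G o\<^sub>L op_powr G (1/2) = G o\<^sub>L G"
    proof -
      have "op_powr G (1/2) o\<^sub>L op_powr G 1 o\<^sub>L op_powr G (1/2) = op_powr G 1 o\<^sub>L op_powr G 1"
        by (simp add: op_powr_add[OF pd(1)])
      then show ?thesis by (simp add: op_powr_1[OF pd(1)])
    qed
    ultimately show ?thesis
      by (simp add: op_powr_add[OF pd(1)] op_powr_1[OF pd(1)])
  qed
  have Y_eq: "Y = G o\<^sub>L V o\<^sub>L G"
    using geo_mean_riccati[OF X Y] by (simp add: G_def V_def)
  \<comment> \<open>Squaring \<open>Y = G V G\<close> puts \<open>G^2\<close> in the middle, where
    \<open>G^2 \<le> G\<close> can be inserted.\<close>
  have "G o\<^sub>L (V o\<^sub>L (G o\<^sub>L G) o\<^sub>L V) o\<^sub>L G \<le>\<^sub>L G o\<^sub>L (V o\<^sub>L G o\<^sub>L V) o\<^sub>L G"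
    by (intro loewner_le_congruence GG sa)
  then have YY: "Y o\<^sub>L Y \<le>\<^sub>L G o\<^sub>L (V o\<^sub>L G o\<^sub>L V) o\<^sub>L G"
    by (simp add: Y_eq blinfun_compose_assoc)
  have "(X o\<^sub>L U o\<^sub>L X) #\<^sub>m (G o\<^sub>L (V o\<^sub>L G o\<^sub>L V) o\<^sub>L G) = G"
  proof (rule geo_mean_eqI)
    show XUX: "X o\<^sub>L U o\<^sub>L X \<in> pos_def" by (intro pos_def_congruence X pd)
    have "op_powr (X o\<^sub>L U o\<^sub>L X) (- 1) = V o\<^sub>L G o\<^sub>L V"
      by (rule op_powr_inverse_eqI[OF XUX], rule blinfun_eqI) (simp add: inv)
    then show "G o\<^sub>L op_powr (X o\<^sub>L U o\<^sub>L X) (- 1) o\<^sub>L G = G o\<^sub>L (V o\<^sub>L G o\<^sub>L V) o\<^sub>L G" by simp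
  qed (rule pd)
  moreover have "(X o\<^sub>L X) #\<^sub>m (Y o\<^sub>L Y) \<le>\<^sub>L (X o\<^sub>L U o\<^sub>L X) #\<^sub>m (G o\<^sub>L (V o\<^sub>L G o\<^sub>L V) o\<^sub>L G)"
    by (intro geo_mean_mono XX YY pos_def_congruence pos_def_square X Y pd)
  ultimately show ?thesis
    using GI loewner_le_trans by metis
qed

section \<open>One-parameter groups and the Loewner--Heinz inequality\<close>

locale pos_def_group =
  fixes F :: "real \<Rightarrow> ('a::complex_hilbert \<Rightarrow>\<^sub>L 'a)"
  assumes pos_def: "F s \<in> pos_def"
    and compose: "F s o\<^sub>L F t = F (s + t)"
    and tendsto: "r \<longlonglongrightarrow> s \<Longrightarrow> (\<lambda>n. F (r n)) \<longlonglongrightarrow> F s"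
begin

lemma zero: "F 0 = id_blinfun"
proof (rule pos_def_square_root_unique[OF pos_def pos_def_id])
  obtain T where T: "F 0 o\<^sub>L T = id_blinfun"
    using pos_def[of 0] by (auto simp: pos_def_def invertible_op_def)
  have "F 0 = F 0 o\<^sub>L (F 0 o\<^sub>L T)" by (simp add: T)
  also have "\<dots> = (F 0 o\<^sub>L F 0) o\<^sub>L T" by (rule blinfun_compose_assoc[symmetric])
  also have "\<dots> = id_blinfun" by (simp add: compose T)
  finally show "F 0 o\<^sub>L F 0 = id_blinfun o\<^sub>L id_blinfun" by simp
qed

lemma inverse: "op_powr (F s) (- 1) = F (- s)"
  by (rule op_powr_inverse_eqI[OF pos_def]) (simp add: compose zero)

text \<open>The Riccati equation holds because \<open>(s + t) / 2 - s + (s + t) / 2 = t\<close>.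
  Monotone means therefore carry inequalities to midpoints of exponents.\<close>

lemma geo_mean: "F s #\<^sub>m F t = F ((s + t) / 2)"
  by (rule geo_mean_eqI[OF pos_def pos_def]) (simp add: inverse compose field_simps)

end

lemma pos_def_group_op_powr:
  assumes "A \<in> pos_def"
  shows "pos_def_group (\<lambda>s. op_powr A (c * s))"
proof
  show "op_powr A (c * s) \<in> pos_def" for s
    by (rule op_powr_pos_def[OF assms])
  show "op_powr A (c * s) o\<^sub>L op_powr A (c * t) = op_powr A (c * (s + t))" for s t
    by (simp add: op_powr_add[OF assms] distrib_left)
  show "(\<lambda>n. op_powr A (c * r n)) \<longlonglongrightarrow> op_powr A (c * s)" if "r \<longlonglongrightarrow> s" for r s
    by (intro op_powr_tendsto assms tendsto_mult_left that)
qed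

locale pos_def_group_pair = F: pos_def_group F + G: pos_def_group G
  for F G :: "real \<Rightarrow> ('a::complex_hilbert \<Rightarrow>\<^sub>L 'a)" +
  assumes le_one: "F 1 \<le>\<^sub>L G 1"
begin

text \<open>\<open>k / 2^(n+1)\<close> is the midpoint of two fractions with denominator
  \<open>2^n\<close>, whose numerators are \<open>k / 2\<close> rounded down and rounded up; for
  even \<open>k\<close> they coincide.\<close>

lemma loewner_heinz_dyadic: "k \<le> 2 ^ n \<Longrightarrow> F (real k / 2 ^ n) \<le>\<^sub>L G (real k / 2 ^ n)"
proof (induction n arbitrary: k)
  case 0
  then consider "k = 0" | "k = 1" by fastforce
  then show ?case
    using le_one by cases (simp_all add: F.zero G.zero loewner_le_refl)
next
  case (Suc n)
  define i where "i = k div 2"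
  define j where "j = (k + 1) div 2"
  have ij: "i \<le> 2 ^ n" "j \<le> 2 ^ n" "k = i + j"
    using Suc.prems by (auto simp: i_def j_def)
  then have k: "real k / 2 ^ Suc n = (real i / 2 ^ n + real j / 2 ^ n) / 2"
    by (simp add: field_simps)
  show ?case
    unfolding k F.geo_mean[symmetric] G.geo_mean[symmetric]
    by (intro geo_mean_mono F.pos_def G.pos_def Suc.IH ij)
qed

text \<open>Rounding down to multiples of \<open>2^-n\<close> gives dyadic exponents tending to
  \<open>q\<close>. Continuity of both groups and closedness of the positive cone carry the
  inequality to the limit.\<close>

lemma loewner_heinz:
  assumes "0 \<le> q" "q \<le> 1"
  shows "F q \<le>\<^sub>L G q"
proof -
  define k where "k n = nat \<lfloor>q * 2 ^ n\<rfloor>" for n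
  define r where "r n = real (k n) / 2 ^ n" for n
  have kq: "real (k n) \<le> q * 2 ^ n" "q * 2 ^ n \<le> real (k n) + 1" for n
    using assms(1) unfolding k_def by simp_all
  have k: "k n \<le> 2 ^ n" for n
  proof -
    have "q * 2 ^ n \<le> 1 * 2 ^ n" by (rule mult_right_mono[OF assms(2)]) simp
    with kq(1)[of n] have "real (k n) \<le> 2 ^ n" unfolding mult_1 by linarith
    then show ?thesis by simp
  qed
  have "r \<longlonglongrightarrow> q"
  proof (rule tendsto_sandwich)
    have "q \<le> (real (k n) + 1) / 2 ^ n" for n
      using kq(2)[of n] by (simp add: pos_le_divide_eq)
    then have "q - (1 / 2) ^ n \<le> r n" for n
      by (simp add: r_def add_divide_distrib power_one_over diff_le_eq)
    then show "\<forall>\<^sub>F n in sequentially. q - (1 / 2) ^ n \<le> r n" by simp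
    show "\<forall>\<^sub>F n in sequentially. r n \<le> q"
      using kq(1) by (simp add: r_def pos_divide_le_eq)
    show "(\<lambda>n. q - (1 / 2) ^ n) \<longlonglongrightarrow> q"
      using tendsto_diff[OF tendsto_const LIMSEQ_realpow_zero[of "1 / 2"], of q] by simp
  qed simp
  then have "(\<lambda>n. G (r n) - F (r n)) \<longlonglongrightarrow> G q - F q"
    by (intro tendsto_diff F.tendsto G.tendsto)
  then show ?thesis
    unfolding loewner_le_def
    by (rule pos_semidef_limit[rotated])
      (use loewner_heinz_dyadic[OF k] in \<open>simp add: r_def loewner_le_def\<close>)
qed

lemma geo_mean_le_id_unit:
  assumes "0 \<le> q" "q \<le> 1"
  shows "G (- q) #\<^sub>m F q \<le>\<^sub>L id_blinfun"
  using geo_mean_mono[OF G.pos_def G.pos_def loewner_le_refl F.pos_def G.pos_def loewner_heinz[OF assms], of "- q"]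
  by (simp add: G.geo_mean G.zero)

lemma geo_mean_le_id:
  assumes "0 \<le> p"
  shows "G (- p) #\<^sub>m F p \<le>\<^sub>L id_blinfun"
proof -
  have scale: "G (- (2 ^ n * q)) #\<^sub>m F (2 ^ n * q) \<le>\<^sub>L id_blinfun" if "0 \<le> q" "q \<le> 1" for n q
  proof (induction n)
    case 0
    show ?case using geo_mean_le_id_unit[OF that] by simp
  next
    case (Suc n)
    from geo_mean_square_le_id[OF G.pos_def F.pos_def this] show ?case
      by (simp add: F.compose G.compose algebra_simps)
  qed
  \<comment> \<open>Halving \<open>p\<close> often enough brings it into the unit interval; each
    squaring then doubles both exponents.\<close>
  obtain n where n: "p < 2 ^ n"
    using real_arch_pow[of 2 p] by auto
  show ?thesis
    using scale[of "p / 2 ^ n" n] assms n by simp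
qed

end

section \<open>From the bound on the mean of powers back to the weighted mean\<close>

theorem theorem3p4:
  fixes A B :: "'a::complex_hilbert \<Rightarrow>\<^sub>L 'a"
  assumes "A \<in> pos_def" and "B \<in> pos_def"
    and "A #\<^sub>m B \<le>\<^sub>L id_blinfun"
  shows "(\<forall>p::real. p > 0 \<longrightarrow> op_powr A (p + 1) #\<^sub>m wgeo_mean A (p / 2) B \<le>\<^sub>L A)
    \<and> op_powr A 3 #\<^sub>m B \<le>\<^sub>L A"
proof -
  note A = assms(1) and B = assms(2)
  define C where "C = op_powr A (- (1/2)) o\<^sub>L B o\<^sub>L op_powr A (- (1/2))"
  have C: "C \<in> pos_def"
    unfolding C_def by (intro pos_def_congruence op_powr_pos_def A B)
  interpret F: pos_def_group "\<lambda>s. op_powr C ((1/2) * s)"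
    by (rule pos_def_group_op_powr[OF C])
  interpret G: pos_def_group "\<lambda>s. op_powr A ((- 1) * s)"
    by (rule pos_def_group_op_powr[OF A])
  interpret pos_def_group_pair "\<lambda>s. op_powr C ((1/2) * s)" "\<lambda>s. op_powr A ((- 1) * s)"
  proof
    have "op_powr A (-1/2) o\<^sub>L (A #\<^sub>m B) o\<^sub>L op_powr A (-1/2)
        \<le>\<^sub>L op_powr A (-1/2) o\<^sub>L id_blinfun o\<^sub>L op_powr A (-1/2)"
      by (intro loewner_le_congruence assms(3) self_adjoint_op_powr A)
    moreover have "op_powr A (-1/2) o\<^sub>L (A #\<^sub>m B) o\<^sub>L op_powr A (-1/2) = op_powr C (1/2)"
      by (rule blinfun_eqI)
        (simp add: geo_mean_def wgeo_mean_def C_def[symmetric] op_powr_apply[OF A] op_powr_0[OF A])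
    ultimately show "op_powr C ((1/2) * 1) \<le>\<^sub>L op_powr A ((- 1) * 1)"
      by (simp add: op_powr_add[OF A])
  qed
  have main: "op_powr A (p + 1) #\<^sub>m wgeo_mean A (p / 2) B \<le>\<^sub>L A" if p: "p > 0" for p :: real
  proof -
    \<comment> \<open>This \<open>D\<close> is the \<open>p\<close>-th power of the operator called
      \<open>D\<close> in the overview.\<close>
    define D where "D = op_powr C (p / 2)"
    define H where "H = op_powr A p #\<^sub>m D"
    have D: "D \<in> pos_def" unfolding D_def by (rule op_powr_pos_def[OF C])
    have H: "H \<in> pos_def" unfolding H_def by (intro geo_mean_pos_def op_powr_pos_def A D)
    have "H \<le>\<^sub>L id_blinfun"
      using geo_mean_le_id[of p] p by (simp add: H_def D_def)
    then have "op_powr A (1/2) o\<^sub>L H o\<^sub>L op_powr A (1/2)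
        \<le>\<^sub>L op_powr A (1/2) o\<^sub>L id_blinfun o\<^sub>L op_powr A (1/2)"
      by (rule loewner_le_congruence) (rule self_adjoint_op_powr[OF A])
    also have "op_powr A (1/2) o\<^sub>L id_blinfun o\<^sub>L op_powr A (1/2) = A"
      by (simp add: op_powr_add[OF A] op_powr_1[OF A])
    finally have le: "op_powr A (1/2) o\<^sub>L H o\<^sub>L op_powr A (1/2) \<le>\<^sub>L A" .
    have inv: "op_powr (op_powr A s) (- 1) = op_powr A (- s)" for s
      by (rule op_powr_inverse_eqI[OF op_powr_pos_def[OF A]])
        (simp add: op_powr_add[OF A] op_powr_0[OF A])
    have HH: "H (op_powr A (- p) (H x)) = D x" for x
      using geo_mean_riccati[OF op_powr_pos_def[OF A, of p] D] unfolding H_def[symmetric] inv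
      by (metis blinfun_apply_blinfun_compose)
    \<comment> \<open>Congruence by \<open>A^(1/2)\<close> passes through the mean. In the Riccati
      equation the middle factor collapses to \<open>A^(1/2) A^(-p-1) A^(1/2) = A^-p\<close>, and
      \<open>H A^-p H = D\<close> leaves \<open>A^(1/2) D A^(1/2)\<close>, the weighted
      mean.\<close>
    have "op_powr A (p + 1) #\<^sub>m wgeo_mean A (p / 2) B = op_powr A (1/2) o\<^sub>L H o\<^sub>L op_powr A (1/2)"
    proof (rule geo_mean_eqI)
      show "op_powr A (p + 1) \<in> pos_def" by (rule op_powr_pos_def[OF A])
      show "op_powr A (1/2) o\<^sub>L H o\<^sub>L op_powr A (1/2) \<in> pos_def"
        by (intro pos_def_congruence op_powr_pos_def A H)
      show "op_powr A (1/2) o\<^sub>L H o\<^sub>L op_powr A (1/2) o\<^sub>L op_powr (op_powr A (p + 1)) (- 1)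
          o\<^sub>L (op_powr A (1/2) o\<^sub>L H o\<^sub>L op_powr A (1/2)) = wgeo_mean A (p / 2) B"
        by (rule blinfun_eqI)
          (simp add: inv wgeo_mean_def C_def[symmetric] D_def[symmetric] op_powr_apply[OF A] HH)
    qed
    with le show ?thesis by simp
  qed
  \<comment> \<open>For \<open>p = 2\<close> the weight is 1 and the outer powers of
    \<open>A\<close> cancel those inside \<open>C\<close>.\<close>
  have "wgeo_mean A 1 B = B"
    by (rule blinfun_eqI)
      (simp add: wgeo_mean_def op_powr_1[OF C, unfolded C_def] op_powr_apply[OF A] op_powr_0[OF A])
  then have "op_powr A 3 #\<^sub>m B \<le>\<^sub>L A"
    using main[of 2] by simp
  with main show ?thesis by blast
qed

end
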